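(* Let $p\ge 1$, let $\Xi=\Xi_1\times\cdots\times\Xi_n$ be a Polish product space with metric $\rho$ on $\Xi$ and metrics $\rho_k$ on $\Xi_k$, $k\in[n]$, and let $\xi=(\xi_1,\ldots,\xi_n)$ be a $\Xi$-valued random variable whose components $\xi_1,\ldots,\xi_n$ are independent and whose distribution $P_\xi$ belongs to $\mathcal P_p(\Xi)$. Let $P_{\xi_k}$ denote the distribution of $\xi_k$. Given i.i.d. samples $\xi^1,\ldots,\xi^N$ of $\xi$, let $P_{\xi_k}^N:=\frac1N\sum_{i=1}^N\delta_{\xi_k^i}$, $k\in[n]$, be the empirical distributions of the components and $\boldsymbol P_\xi^N:=P_{\xi_1}^N\otimes\cdots\otimes P_{\xi_n}^N$. Let $\varepsilon_k>0$, $\beta_k\in[0,1]$, and assume that for each $k\in[n]$ the Wasserstein ball $\mathcal B_p(P_{\xi_k}^N,\varepsilon_k)$ contains $P_{\xi_k}$ with confidence $1-\beta_k$, i.e., $\mathbb P\big(P_{\xi_k}\in\mathcal B_p(P_{\xi_k}^N,\varepsilon_k)\big)\ge1-\beta_k$. Then the multi-transport hyperrectangle $\mathcal T_p(\boldsymbol P_\xi^N,\boldsymbol\varepsilon)$ contains $P_\xi$ with confidence $\prod_{k=1}^n(1-\beta_k)$, i.e., $$\mathbb P\big(P_\xi\in\mathcal T_p(\boldsymbol P_\xi^N,\boldsymbol\varepsilon)\big)\ge\prod_{k=1}^n(1-\beta_k).$$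
   Context: $[n]=\{1,\ldots,n\}$. A Polish space is a complete separable metric space, with its Borel $\sigma$-algebra; $\Xi$ carries the product topology, metrized by $\rho$. $\mathcal P(S)$ is the set of Borel probability measures on a Polish space $S$, and $\mathcal P_p(S)$ the subset with finite $p$th moment. For a Polish space $(S,d)$ and $Q,P\in\mathcal P_p(S)$, $W_p(Q,P):=\big(\inf_{\pi\in\mathcal C(Q,P)}\int_{S\times S}d(\zeta,\xi)^p\,d\pi(\zeta,\xi)\big)^{1/p}$, where $\mathcal C(Q,P)$ is the set of probability measures on $S\times S$ with first marginal $Q$ and second marginal $P$, and $\mathcal B_p(Q,\varepsilon):=\{P\in\mathcal P_p(S):W_p(Q,P)\le\varepsilon\}$ (on $\Xi_k$ the metric $\rho_k$ is used). For $Q\in\mathcal P(\Xi)$ and $\boldsymbol\varepsilon=(\varepsilon_1,\ldots,\varepsilon_n)$ with positive entries, the multi-transport hyperrectangle $\mathcal T_p(Q,\boldsymbol\varepsilon)$ is the set of all second marginals $\mathrm{pr}_{2\#}\pi$ of probability measures $\pi\in\mathcal P(\Xi\times\Xi)$ with first marginal $\mathrm{pr}_{1\#}\pi=Q$ and $\int_{\Xi\times\Xi}\rho_k(\zeta_k,\xi_k)^p\,d\pi(\zeta,\xi)\le\varepsilon_k^p$ for all $k\in[n]$. Here $\xi_k^i$ denotes the $k$th component of the sample $\xi^i$. *)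

theory Defs
  imports "HOL-Probability.Probability"
begin

text \<open>
  The factors of a product space may be different spaces, so they are not modelled by one
  type of class \<open>polish_space\<close> but by a family of values of type \<open>'a metric\<close>, i.e. metric
  spaces with arbitrary carriers inside a common type \<open>'a\<close>. Points of the product are the
  extensional functions in \<open>\<Pi>\<^sub>E k\<in>{1..n}. mspace (m k)\<close>.
\<close>

definition polish_metric :: "'a metric \<Rightarrow> bool" where
  "polish_metric m \<longleftrightarrow> mcomplete_of m \<and> separable_space (mtopology_of m)"

definition borel_alg :: "'a topology \<Rightarrow> 'a measure" where
  "borel_alg X = sigma (topspace X) {U. openin X U}"

abbreviation mborel :: "'a metric \<Rightarrow> 'a measure" where
  "mborel m \<equiv> borel_alg (mtopology_of m)"

definition borel_probs :: "'a topology \<Rightarrow> 'a measure set" where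
  "borel_probs X = {P. prob_space P \<and> sets P = sets (borel_alg X)}"

text \<open>Finiteness of the moment does not depend on the base point, as \<open>p\<close> is positive.\<close>

definition probs_moment :: "real \<Rightarrow> 'a metric \<Rightarrow> 'a measure set" where
  "probs_moment p m = {P \<in> borel_probs (mtopology_of m).
     \<exists>x0\<in>mspace m. (\<integral>\<^sup>+ x. ennreal (mdist m x0 x powr p) \<partial>P) < \<infinity>}"

text \<open>
  \<open>transport_plans m\<close> is the set of all Borel probability measures on the square of the space,
  equipped with the product topology.
\<close>

definition transport_plans :: "'a metric \<Rightarrow> ('a \<times> 'a) measure set" where
  "transport_plans m = borel_probs (prod_topology (mtopology_of m) (mtopology_of m))"

definition couplings :: "'a metric \<Rightarrow> 'a measure \<Rightarrow> 'a measure \<Rightarrow> ('a \<times> 'a) measure set" where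
  "couplings m Q P = {\<pi> \<in> transport_plans m.
     distr \<pi> (mborel m) fst = Q \<and> distr \<pi> (mborel m) snd = P}"

text \<open>
  For \<open>Q\<close> and \<open>P\<close> in \<open>probs_moment p m\<close> the infimum is finite (the product measure is a coupling
  of finite cost), so \<open>enn2real\<close> loses nothing there. Outside of \<open>probs_moment p m\<close> the value
  carries no meaning.
\<close>

definition wasserstein :: "real \<Rightarrow> 'a metric \<Rightarrow> 'a measure \<Rightarrow> 'a measure \<Rightarrow> real" where
  "wasserstein p m Q P =
     enn2real (\<Sqinter>\<pi>\<in>couplings m Q P.
       \<integral>\<^sup>+ z. ennreal (mdist m (fst z) (snd z) powr p) \<partial>\<pi>) powr (1 / p)"

definition wasserstein_ball :: "real \<Rightarrow> 'a metric \<Rightarrow> 'a measure \<Rightarrow> real \<Rightarrow> 'a measure set" where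
  "wasserstein_ball p m Q \<epsilon> = {P \<in> probs_moment p m. wasserstein p m Q P \<le> \<epsilon>}"

definition polish_product ::
  "nat \<Rightarrow> (nat \<Rightarrow> 'a metric) \<Rightarrow> (nat \<Rightarrow> 'a) metric \<Rightarrow> bool" where
  "polish_product n m \<rho> \<longleftrightarrow>
     (\<forall>k\<in>{1..n}. polish_metric (m k)) \<and> polish_metric \<rho> \<and>
     mtopology_of \<rho> = product_topology (\<lambda>k. mtopology_of (m k)) {1..n}"

definition multi_transport_hyperrectangle ::
  "real \<Rightarrow> nat \<Rightarrow> (nat \<Rightarrow> 'a metric) \<Rightarrow> (nat \<Rightarrow> 'a) metric \<Rightarrow>
   (nat \<Rightarrow> 'a) measure \<Rightarrow> (nat \<Rightarrow> real) \<Rightarrow> (nat \<Rightarrow> 'a) measure set" where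
  "multi_transport_hyperrectangle p n m \<rho> Q \<epsilon> =
     {distr \<pi> (mborel \<rho>) snd |\<pi>.
        \<pi> \<in> transport_plans \<rho> \<and> distr \<pi> (mborel \<rho>) fst = Q \<and>
        (\<forall>k\<in>{1..n}. (\<integral>\<^sup>+ z. ennreal (mdist (m k) (fst z k) (snd z k) powr p) \<partial>\<pi>)
            \<le> ennreal (\<epsilon> k powr p))}"

definition empirical :: "'a measure \<Rightarrow> nat \<Rightarrow> (nat \<Rightarrow> 'a) \<Rightarrow> 'a measure" where
  "empirical B N x = measure_of (space B) (sets B)
     (\<lambda>A. (1 / of_nat N) * (\<Sum>i\<in>{1..N}. emeasure (return B (x i)) A))"

lemma sets_empirical [simp]: "sets (empirical B N x) = sets B"
  by (simp add: empirical_def)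

lemma space_empirical [simp]: "space (empirical B N x) = space B"
  by (simp add: empirical_def)

lemma emeasure_empirical:
  assumes A: "A \<in> sets B"
  shows "emeasure (empirical B N x) A
    = (1 / of_nat N) * (\<Sum>i\<in>{1..N}. emeasure (return B (x i)) A)"
proof (rule emeasure_measure_of[OF empirical_def])
  show "sets B \<subseteq> Pow (space B)" by (rule sets.space_closed)
  show "A \<in> sets (empirical B N x)" using A by simp
  show "positive (sets (empirical B N x))
     (\<lambda>A. (1 / of_nat N) * (\<Sum>i\<in>{1..N}. emeasure (return B (x i)) A))"
    by (simp add: positive_def)
  show "countably_additive (sets (empirical B N x))
     (\<lambda>A. (1 / of_nat N) * (\<Sum>i\<in>{1..N}. emeasure (return B (x i)) A))"
  proof (rule countably_additiveI)
    fix F :: "nat \<Rightarrow> 'a set"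
    assume F: "range F \<subseteq> sets (empirical B N x)" "disjoint_family F"
    have s: "(\<Sum>j. emeasure (return B (x i)) (F j)) = emeasure (return B (x i)) (\<Union>j. F j)" for i
      using F by (intro suminf_emeasure) auto
    have "(\<Sum>j. (1 / of_nat N) * (\<Sum>i\<in>{1..N}. emeasure (return B (x i)) (F j)))
      = (1 / of_nat N) * (\<Sum>j. \<Sum>i\<in>{1..N}. emeasure (return B (x i)) (F j))"
      by (rule ennreal_suminf_cmult)
    also have "(\<Sum>j. \<Sum>i\<in>{1..N}. emeasure (return B (x i)) (F j))
      = (\<Sum>i\<in>{1..N}. \<Sum>j. emeasure (return B (x i)) (F j))"
      by (intro suminf_sum) auto
    finally show "(\<Sum>j. (1 / of_nat N) * (\<Sum>i\<in>{1..N}. emeasure (return B (x i)) (F j)))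
      = (1 / of_nat N) * (\<Sum>i\<in>{1..N}. emeasure (return B (x i)) (\<Union>j. F j))"
      by (simp add: s)
  qed
qed

text \<open>
  \<open>PiM\<close> yields the product \<open>\<sigma>\<close>-algebra, which for a product of separable metric spaces is the
  Borel \<open>\<sigma>\<close>-algebra of the product topology.
\<close>

definition product_empirical ::
  "nat \<Rightarrow> (nat \<Rightarrow> 'a metric) \<Rightarrow> nat \<Rightarrow> (nat \<Rightarrow> nat \<Rightarrow> 'a) \<Rightarrow> (nat \<Rightarrow> 'a) measure" where
  "product_empirical n m N x = PiM {1..n} (\<lambda>k. empirical (mborel (m k)) N (\<lambda>i. x i k))"

end

theory Submission
  imports Defs
begin

text \<open>
  The event of the theorem is the intersection over \<open>k\<close> of the events that the \<open>k\<close>-th Wasserstein ball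
  contains the law of the \<open>k\<close>-th component: a plan on the product projects to couplings of the
  components, and conversely the product of optimal couplings of the components is a plan on the product.
  Independence of the components then gives the product of the probabilities.

  Optimal couplings exist and the events are measurable because the first marginal is an empirical
  measure: a coupling of it with \<open>P\<close> amounts to densities \<open>f (i, \<cdot>)\<close> with respect to \<open>P\<close>, one for each sample
  point, that take values in \<open>[0, 1]\<close>, have integral \<open>1 / N\<close> and sum to \<open>1\<close>. This convex set does not
  depend on the sample. A Hilbert space argument gives a minimizer of the cost, and the minimal cost
  is an infimum of continuous functions of the sample, hence upper semicontinuous. Measurability cannot be
  bypassed, as the measure of a non-measurable set is \<open>0\<close> by convention; if all \<open>\<beta>\<^sub>k < 1\<close>, that convention also
  makes the balls nonempty, which yields the moments of the components.
\<close>

section \<open>Borel algebras of product topologies\<close>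

lemma space_borel_alg [simp]: "space (borel_alg X) = topspace X"
  unfolding borel_alg_def by (rule space_measure_of) (auto dest: openin_subset)

lemma sets_borel_alg: "sets (borel_alg X) = sigma_sets (topspace X) {U. openin X U}"
  unfolding borel_alg_def by (rule sets_measure_of) (auto dest: openin_subset)

lemma openin_imp_borel_alg: "openin X U \<Longrightarrow> U \<in> sets (borel_alg X)"
  by (auto simp: sets_borel_alg)

lemma measurable_borel_algI:
  assumes "\<And>x. x \<in> space M \<Longrightarrow> f x \<in> topspace X"
    and "\<And>U. openin X U \<Longrightarrow> f -` U \<inter> space M \<in> sets M"
  shows "f \<in> measurable M (borel_alg X)"
  unfolding borel_alg_def using assms
  by (intro measurable_measure_of) (auto dest: openin_subset)

lemma continuous_map_measurable:
  assumes "continuous_map X Y f"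
  shows "f \<in> measurable (borel_alg X) (borel_alg Y)"
proof (rule measurable_borel_algI)
  fix U assume "openin Y U"
  then have "openin X {x \<in> topspace X. f x \<in> U}"
    using assms by (simp add: continuous_map_def)
  then show "f -` U \<inter> space (borel_alg X) \<in> sets (borel_alg X)"
    by (intro openin_imp_borel_alg) (simp add: vimage_def Int_def conj_commute)
qed (use assms in \<open>auto simp: continuous_map_def\<close>)

lemma continuous_map_borel_measurable:
  fixes f :: "'a \<Rightarrow> 'b::topological_space"
  assumes "continuous_map X euclidean f"
  shows "f \<in> borel_measurable (borel_alg X)"
proof -
  have "borel_alg (euclidean :: 'b topology) = borel"
    by (simp add: borel_alg_def borel_def)
  then show ?thesis
    using continuous_map_measurable[OF assms] by simp
qed

text \<open>Balls of rational radius about the points of a countable dense set form a base. Second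
  countability is what allows Borel algebras of products to be computed from those of the
  factors.\<close>

lemma separable_metric_imp_second_countable:
  assumes "separable_space (mtopology_of m)"
  shows "second_countable (mtopology_of m)"
proof -
  interpret Metric_space "mspace m" "mdist m" by simp
  obtain D where D: "countable D" "D \<subseteq> mspace m" "mtopology closure_of D = mspace m"
    using assms by (auto simp: separable_space_def mtopology_of_def)
  define \<B> where "\<B> = (\<lambda>(x, q). mball x (real_of_rat q)) ` (D \<times> UNIV)"
  have "\<exists>V\<in>\<B>. x \<in> V \<and> V \<subseteq> U" if U: "openin mtopology U" and x: "x \<in> U" for U x
  proof -
    obtain r where r: "r > 0" "mball x r \<subseteq> U"
      using U x openin_mtopology by auto
    have xm: "x \<in> mspace m"
      using U x openin_mtopology by auto
    \<comment> \<open>With radius below \<open>r / 2\<close>, a ball about a dense point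
      \<open>d\<close> that contains \<open>x\<close> stays inside the \<open>r\<close>-ball about
      \<open>x\<close>.\<close>
    obtain q where q: "0 < real_of_rat q" "real_of_rat q < r / 2"
      using of_rat_dense[of 0 "r / 2"] r by auto
    have "x \<in> mtopology closure_of D"
      using D(3) xm by simp
    then obtain d where d: "d \<in> D" "d \<in> mball x (real_of_rat q)"
      unfolding metric_closure_of using q(1) by blast
    show ?thesis
    proof (intro bexI[of _ "mball d (real_of_rat q)"] conjI)
      show "mball d (real_of_rat q) \<subseteq> U"
      proof
        fix y assume y: "y \<in> mball d (real_of_rat q)"
        then have "mdist m x y < r"
          using d q triangle[of x d y] by auto
        then show "y \<in> U"
          using r y xm by auto
      qed
      show "x \<in> mball d (real_of_rat q)"
        using d by (auto simp: commute)
      show "mball d (real_of_rat q) \<in> \<B>"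
        using d by (auto simp: \<B>_def)
    qed
  qed
  moreover have "countable \<B>"
    unfolding \<B>_def using D(1) by simp
  moreover have "\<forall>V\<in>\<B>. openin mtopology V"
    by (auto simp: \<B>_def)
  ultimately show ?thesis
    unfolding second_countable_def mtopology_of_def by blast
qed

lemma sets_subset_if_ident_measurable:
  assumes "(\<lambda>x. x) \<in> measurable M N" "space M = space N"
  shows "sets N \<subseteq> sets M"
proof
  fix A assume A: "A \<in> sets N"
  then have "(\<lambda>x. x) -` A \<inter> space M \<in> sets M"
    by (rule measurable_sets[OF assms(1)])
  also have "(\<lambda>x. x) -` A \<inter> space M = A"
    using sets.sets_into_space[OF A] assms(2) by blast
  finally show "A \<in> sets M" .
qed

text \<open>Continuity of the projections gives one inclusion. For the other, countable bases of the
  finitely many factors give countably many basic boxes, so every open set of the product is a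
  countable union of measurable boxes.\<close>

lemma sets_borel_alg_product_topology:
  assumes I: "finite I" and X: "\<And>i. i \<in> I \<Longrightarrow> second_countable (X i)"
  shows "sets (borel_alg (product_topology X I)) = sets (PiM I (\<lambda>i. borel_alg (X i)))"
    (is "sets ?B = sets ?P")
proof -
  have sp: "space ?B = space ?P"
    by (simp add: space_PiM)
  have "(\<lambda>x. x) \<in> measurable ?B ?P"
  proof (rule measurable_PiM_single')
    show "(\<lambda>\<omega> i. \<omega> i) \<in> space ?B \<rightarrow> (\<Pi>\<^sub>E i\<in>I. space (borel_alg (X i)))"
      by auto
    fix i assume "i \<in> I"
    then show "(\<lambda>\<omega>. \<omega> i) \<in> measurable ?B (borel_alg (X i))"
      by (intro continuous_map_measurable continuous_map_product_projection)
  qed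
  then have 1: "sets ?P \<subseteq> sets ?B"
    by (rule sets_subset_if_ident_measurable) (rule sp)
  have "\<forall>i\<in>I. \<exists>\<B>. countable \<B> \<and> (\<forall>V\<in>\<B>. openin (X i) V) \<and>
      (\<forall>U x. openin (X i) U \<and> x \<in> U \<longrightarrow> (\<exists>V\<in>\<B>. x \<in> V \<and> V \<subseteq> U))"
    using X unfolding second_countable_def by blast
  then obtain \<B> where "\<forall>i\<in>I. countable (\<B> i) \<and> (\<forall>V\<in>\<B> i. openin (X i) V) \<and>
      (\<forall>U x. openin (X i) U \<and> x \<in> U \<longrightarrow> (\<exists>V\<in>\<B> i. x \<in> V \<and> V \<subseteq> U))"
    by (rule bchoice[THEN exE])
  then have \<B>: "\<And>i. i \<in> I \<Longrightarrow> countable (\<B> i)" "\<And>i V. i \<in> I \<Longrightarrow> V \<in> \<B> i \<Longrightarrow> openin (X i) V"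
      "\<And>i U x. i \<in> I \<Longrightarrow> openin (X i) U \<Longrightarrow> x \<in> U \<Longrightarrow> \<exists>V\<in>\<B> i. x \<in> V \<and> V \<subseteq> U"
    by blast+
  have "U \<in> sets ?P" if U: "openin (product_topology X I) U" for U
  proof -
    define \<C> where "\<C> = {V \<in> PiE I \<B>. PiE I V \<subseteq> U}"
    have "countable \<C>"
      unfolding \<C>_def using countable_PiE[OF I, of \<B>] \<B>(1) by (auto intro: countable_subset)
    moreover have "PiE I V \<in> sets ?P" if "V \<in> \<C>" for V
      using that \<B>(2) I by (intro sets_PiM_I_finite openin_imp_borel_alg) (auto simp: \<C>_def PiE_iff)
    ultimately have "(\<Union>V\<in>\<C>. PiE I V) \<in> sets ?P"
      by (intro sets.countable_UN') auto
    also have "(\<Union>V\<in>\<C>. PiE I V) = U"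
    proof
      show "U \<subseteq> (\<Union>V\<in>\<C>. PiE I V)"
      proof
        fix x assume x: "x \<in> U"
        obtain W where W: "\<forall>i\<in>I. openin (X i) (W i)" "x \<in> PiE I W" "PiE I W \<subseteq> U"
          using U x unfolding openin_product_topology_alt by metis
        have "\<exists>V. V \<in> \<B> i \<and> x i \<in> V \<and> V \<subseteq> W i" if "i \<in> I" for i
          using \<B>(3)[OF that, of "W i" "x i"] W that unfolding PiE_iff by blast
        then obtain V where V: "\<And>i. i \<in> I \<Longrightarrow> V i \<in> \<B> i \<and> x i \<in> V i \<and> V i \<subseteq> W i"
          by metis
        \<comment> \<open>The families in \<open>\<C>\<close> are extensional, so the chosen family
          is restricted to \<open>I\<close>; its box stays the same.\<close>
        have eq: "PiE I (restrict V I) = PiE I V"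
          by (rule PiE_cong) auto
        have "PiE I V \<subseteq> PiE I W"
          using V by (intro PiE_mono) auto
        then have "restrict V I \<in> \<C>"
          using V W(3) by (auto simp: \<C>_def eq)
        moreover have "x \<in> PiE I (restrict V I)"
          using V W(2) by (auto simp: PiE_iff)
        ultimately show "x \<in> (\<Union>V\<in>\<C>. PiE I V)" by blast
      qed
    qed (auto simp: \<C>_def)
    finally show ?thesis .
  qed
  then have "sets ?B \<subseteq> sets ?P"
    unfolding sets_borel_alg using sp
    by (intro sets.sigma_sets_subset') auto
  with 1 show ?thesis by auto
qed

text \<open>The argument for finite products, with rectangles of basic sets as boxes. It identifies
  the \<sigma>-algebra of transport plans with \<open>\<Otimes>\<^sub>M\<close>, so that the
  measurability rules for pairs apply to plans.\<close>

lemma sets_borel_alg_prod_topology: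
  assumes "second_countable X" "second_countable Y"
  shows "sets (borel_alg (prod_topology X Y)) = sets (borel_alg X \<Otimes>\<^sub>M borel_alg Y)"
    (is "sets ?B = sets ?P")
proof -
  have sp: "space ?B = space ?P"
    by (simp add: space_pair_measure)
  have "(\<lambda>x. (fst x, snd x)) \<in> measurable ?B ?P"
    by (intro measurable_Pair continuous_map_measurable continuous_map_fst continuous_map_snd)
  then have "(\<lambda>x. x) \<in> measurable ?B ?P" by simp
  then have 1: "sets ?P \<subseteq> sets ?B"
    by (rule sets_subset_if_ident_measurable) (rule sp)
  obtain \<B> where \<B>: "countable \<B>" "\<And>V. V \<in> \<B> \<Longrightarrow> openin X V"
      "\<And>U x. openin X U \<Longrightarrow> x \<in> U \<Longrightarrow> \<exists>V\<in>\<B>. x \<in> V \<and> V \<subseteq> U"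
    using assms(1) unfolding second_countable_def by (elim exE conjE) blast
  obtain \<C> where \<C>: "countable \<C>" "\<And>V. V \<in> \<C> \<Longrightarrow> openin Y V"
      "\<And>U x. openin Y U \<Longrightarrow> x \<in> U \<Longrightarrow> \<exists>V\<in>\<C>. x \<in> V \<and> V \<subseteq> U"
    using assms(2) unfolding second_countable_def by (elim exE conjE) blast
  have "U \<in> sets ?P" if U: "openin (prod_topology X Y) U" for U
  proof -
    define \<D> where "\<D> = {(V, W). V \<in> \<B> \<and> W \<in> \<C> \<and> V \<times> W \<subseteq> U}"
    have "\<D> \<subseteq> \<B> \<times> \<C>"
      by (auto simp: \<D>_def)
    then have "countable \<D>"
      by (rule countable_subset) (intro countable_SIGMA \<B>(1) \<C>(1))
    moreover have "V \<times> W \<in> sets ?P" if "(V, W) \<in> \<D>" for V W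
      using that \<B>(2) \<C>(2) by (intro pair_measureI openin_imp_borel_alg) (auto simp: \<D>_def)
    ultimately have "(\<Union>(V, W)\<in>\<D>. V \<times> W) \<in> sets ?P"
      by (intro sets.countable_UN') auto
    also have "(\<Union>(V, W)\<in>\<D>. V \<times> W) = U"
    proof
      show "U \<subseteq> (\<Union>(V, W)\<in>\<D>. V \<times> W)"
      proof clarify
        fix x y assume xy: "(x, y) \<in> U"
        obtain V W where VW: "openin X V" "openin Y W" "x \<in> V" "y \<in> W" "V \<times> W \<subseteq> U"
          using U[unfolded openin_prod_topology_alt, rule_format, OF xy] by metis
        obtain V' W' where "V' \<in> \<B>" "x \<in> V'" "V' \<subseteq> V" "W' \<in> \<C>" "y \<in> W'" "W' \<subseteq> W"
          using \<B>(3)[OF VW(1,3)] \<C>(3)[OF VW(2,4)] by metis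
        then show "(x, y) \<in> (\<Union>(V, W)\<in>\<D>. V \<times> W)"
          using VW(5) by (intro UN_I[of "(V', W')"]) (auto simp: \<D>_def)
      qed
    qed (auto simp: \<D>_def)
    finally show ?thesis .
  qed
  then have "sets ?B \<subseteq> sets ?P"
    unfolding sets_borel_alg using sp
    by (intro sets.sigma_sets_subset') auto
  with 1 show ?thesis by auto
qed

section \<open>Sequences of midpoint-convex sets of bounded functions\<close>

text \<open>The partial sums of the increments telescope to \<open>u 0 - u n\<close>.\<close>

lemma convergent_if_summable_increments:
  fixes u :: "nat \<Rightarrow> real"
  assumes "summable (\<lambda>r. \<bar>u r - u (Suc r)\<bar>)"
  shows "convergent u"
proof -
  have "summable (\<lambda>r. u r - u (Suc r))"
    by (rule summable_rabs_cancel) (rule assms)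
  then have "convergent (\<lambda>n. \<Sum>r<n. u r - u (Suc r))"
    by (simp add: summable_iff_convergent)
  then have "convergent (\<lambda>n. u 0 - (\<Sum>r<n. u r - u (Suc r)))"
    by (intro convergent_diff convergent_const)
  moreover have "(\<Sum>r<n. u r - u (Suc r)) = u 0 - u n" for n
    by (induction n) auto
  ultimately show ?thesis by simp
qed

text \<open>
  Near-minimizers of the square norm in the sets \<open>K j\<close> form a Cauchy sequence in the square norm,
  by the parallelogram identity.
\<close>

lemma (in finite_measure) midpoint_convex_sequence_converges:
  fixes K :: "nat \<Rightarrow> ('a \<Rightarrow> real) set"
  assumes ne: "\<And>j. K j \<noteq> {}" and dec: "decseq K"
    and meas [measurable]: "\<And>j g. g \<in> K j \<Longrightarrow> g \<in> borel_measurable M"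
    and bnd: "\<And>j g x. g \<in> K j \<Longrightarrow> 0 \<le> g x \<and> g x \<le> 1"
    and mid: "\<And>j f g. f \<in> K j \<Longrightarrow> g \<in> K j \<Longrightarrow> (\<lambda>x. (f x + g x) / 2) \<in> K j"
  obtains h l where "\<And>j. h j \<in> K j" "l \<in> borel_measurable M" "\<And>x. 0 \<le> l x \<and> l x \<le> 1"
    "AE x in M. (\<lambda>j. h j x) \<longlonglongrightarrow> l x"
proof -
  define sq where "sq g = (\<integral>x. (g x)\<^sup>2 \<partial>M)" for g :: "'a \<Rightarrow> real"
  \<comment> \<open>As \<open>K\<close> decreases, these infima increase. They are bounded by the
    total mass, since all functions lie between 0 and 1, so \<open>d\<close> is a Cauchy
    sequence.\<close>
  define d where "d j = Inf (sq ` K j)" for j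
  have KK: "K l \<subseteq> K j" if "j \<le> l" for j l
    using dec that by (auto simp: decseq_def)
  have int: "integrable M g" if "g \<in> borel_measurable M" "\<And>x. \<bar>g x\<bar> \<le> 1" for g :: "'a \<Rightarrow> real"
    using that by (intro integrable_const_bound[of _ 1]) auto
  have sq01: "\<bar>a * b\<bar> \<le> 1" if "0 \<le> a \<and> a \<le> 1" "0 \<le> b \<and> b \<le> 1" for a b :: real
    using that mult_le_one[of a b] by (simp add: abs_mult)
  have intprod: "integrable M (\<lambda>x. f x * g x)" if "f \<in> K j" "g \<in> K l" for f g j l
    using that bnd by (intro int sq01) auto
  have sq_ge0: "0 \<le> sq g" for g
    by (simp add: sq_def)
  have bdd: "bdd_below (sq ` K j)" for j
    by (rule bdd_belowI[of _ 0]) (auto simp: sq_ge0)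
  have d_le: "d j \<le> sq g" if "g \<in> K j" for j g
    unfolding d_def using that bdd by (intro cInf_lower) auto
  have "\<exists>g\<in>K j. sq g < d j + 1 / real (Suc j)" for j
    using cInf_lessD[of "sq ` K j" "d j + 1 / real (Suc j)"] ne[of j] by (auto simp: d_def)
  then obtain g where g: "\<And>j. g j \<in> K j" "\<And>j. sq (g j) < d j + 1 / real (Suc j)"
    by metis
  have d_mono: "d j \<le> d l" if "j \<le> l" for j l
    unfolding d_def using KK[OF that] ne bdd by (intro cInf_superset_mono) auto
  have "d j \<le> measure M (space M)" for j
  proof -
    have "sq (g j) \<le> (\<integral>x. 1 \<partial>M)"
      unfolding sq_def using g(1)[of j] bnd
      by (intro integral_mono) (auto simp: power2_eq_square intro!: int sq01 mult_le_one)
    with d_le[OF g(1)[of j]] show ?thesis by simp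
  qed
  then have "convergent d"
    using d_mono unfolding convergent_def
    by (metis incseq_convergent[of d "measure M (space M)"] incseq_def)
  then have Cd: "Cauchy d" by (rule convergent_Cauchy)
  \<comment> \<open>Parallelogram identity: the midpoint of \<open>g j\<close> and
    \<open>g l\<close> lies in \<open>K j\<close>, so its square norm is at least
    \<open>d j\<close>, while those of \<open>g j\<close> and \<open>g l\<close> barely exceed
    \<open>d j\<close> and \<open>d l\<close>.\<close>
  have par: "(\<integral>x. (g j x - g l x)\<^sup>2 \<partial>M) \<le> 2 * (d l - d j) + 4 / real (Suc j)" if "j \<le> l" for j l
  proof -
    have gl: "g l \<in> K j" using g(1)[of l] KK[OF that] by auto
    have "(\<lambda>x. (g j x - g l x)\<^sup>2) =
        (\<lambda>x. 2 * (g j x)\<^sup>2 + 2 * (g l x)\<^sup>2 - 4 * ((g j x + g l x) / 2)\<^sup>2)"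
      by (auto simp: power2_eq_square field_simps)
    then have "(\<integral>x. (g j x - g l x)\<^sup>2 \<partial>M) = 2 * sq (g j) + 2 * sq (g l) - 4 * sq (\<lambda>x. (g j x + g l x) / 2)"
      unfolding sq_def
      using intprod[OF g(1) g(1), of j j] intprod[OF g(1) g(1), of l l]
        intprod[OF mid[OF g(1) gl] mid[OF g(1) gl]]
      by (simp add: power2_eq_square del: times_divide_eq_left times_divide_eq_right)
    moreover have "d j \<le> sq (\<lambda>x. (g j x + g l x) / 2)"
      by (intro d_le mid g gl)
    moreover have "1 / real (Suc l) \<le> 1 / real (Suc j)"
      using that by (simp add: frac_le)
    ultimately show ?thesis
      using g(2)[of j] g(2)[of l] by simp
  qed
  have ab: "2 * (y - x) \<le> a / 2" if "\<bar>x - y\<bar> < a / 4" for x y a :: real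
    using that unfolding abs_less_iff by (simp add: field_simps)
  \<comment> \<open>The rate \<open>(1/4)^r\<close> for squared distances is chosen so that the L1
    norms of the increments along a subsequence are summable.\<close>
  have "\<exists>s. \<forall>j l. s \<le> j \<longrightarrow> j \<le> l \<longrightarrow> (\<integral>x. (g j x - g l x)\<^sup>2 \<partial>M) \<le> (1/4)^r" for r
  proof -
    have e: "0 < (1/4::real)^r / 4" by simp
    obtain s1 where s1: "\<And>j l. s1 \<le> j \<Longrightarrow> s1 \<le> l \<Longrightarrow> dist (d j) (d l) < (1/4)^r / 4"
      using Cd e unfolding Cauchy_def by metis
    obtain s2 where s2: "inverse (real (Suc s2)) < (1/4)^r / 8"
      using reals_Archimedean[of "(1/4)^r / 8"] by auto
    show ?thesis
    proof (intro exI[of _ "max s1 s2"] allI impI)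
      fix j l assume jl: "max s1 s2 \<le> j" "j \<le> l"
      have "1 / real (Suc j) \<le> 1 / real (Suc s2)"
        using jl by (simp add: frac_le)
      then have "4 / real (Suc j) \<le> (1/4)^r / 2"
        using s2 by (simp add: inverse_eq_divide)
      moreover have "dist (d j) (d l) < (1/4)^r / 4"
        using jl by (intro s1) auto
      then have "2 * (d l - d j) \<le> (1/4)^r / 2"
        using ab[of "d j" "d l" "(1/4)^r"] unfolding dist_real_def by simp
      ultimately show "(\<integral>x. (g j x - g l x)\<^sup>2 \<partial>M) \<le> (1/4)^r"
        using par[OF jl(2)] by simp
    qed
  qed
  then obtain s where s: "\<And>r j l. s r \<le> j \<Longrightarrow> j \<le> l \<Longrightarrow> (\<integral>x. (g j x - g l x)\<^sup>2 \<partial>M) \<le> (1/4)^r"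
    by metis
  \<comment> \<open>The summand \<open>r\<close> gives \<open>t r\<close> at least \<open>r\<close>,
    which puts \<open>g (t r)\<close> into \<open>K r\<close>; the sum gives monotonicity and
    \<open>t r\<close> at least \<open>s r\<close>, which yields the rate.\<close>
  define t where "t r = r + (\<Sum>q\<le>r. s q)" for r
  have t: "r \<le> t r" "s r \<le> t r" "t r \<le> t (Suc r)" for r
    by (auto simp: t_def intro!: member_le_sum trans_le_add2)
  define h where "h r = g (t r)" for r
  have hK: "h r \<in> K r" for r
    using g(1)[of "t r"] KK[OF t(1)[of r]] by (auto simp: h_def)
  note [measurable] = meas[OF hK]
  have hdiff: "\<bar>h r x - h (Suc r) x\<bar> \<le> 1" for r x
    using bnd[OF hK[of r], of x] bnd[OF hK[of "Suc r"], of x] by linarith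
  have L1: "(\<integral>x. \<bar>h r x - h (Suc r) x\<bar> \<partial>M) \<le> (1/2)^r * (measure M (space M) + 1)" for r
  proof -
    \<comment> \<open>Weighted arithmetic-geometric mean inequality. The weight \<open>2^r\<close>
      balances a square integral of order \<open>(1/4)^r\<close> against the constant
      \<open>(1/2)^r\<close>, so the L1 norm is of order \<open>(1/2)^r\<close>.\<close>
    have am: "\<bar>a\<bar> \<le> (1/2)^r + 2^r * a\<^sup>2" for a :: real
    proof -
      have "0 \<le> (1/2)^r * (1 - 2^r * \<bar>a\<bar>)\<^sup>2" by simp
      also have "\<dots> = (1/2)^r - 2 * ((1/2)^r * 2^r) * \<bar>a\<bar> + ((1/2)^r * 2^r) * 2^r * a\<^sup>2"
        by (simp add: power2_eq_square algebra_simps abs_mult_self_eq del: power_divide)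
      also have "(1/2::real)^r * 2^r = 1"
        by (simp flip: power_mult_distrib)
      finally have "2 * \<bar>a\<bar> \<le> (1/2)^r + 2^r * a\<^sup>2" by simp
      then show ?thesis by linarith
    qed
    have i2: "integrable M (\<lambda>x. (h r x - h (Suc r) x)\<^sup>2)"
      using hdiff[of r] by (intro int) (auto simp: abs_square_le_1)
    have i1: "integrable M (\<lambda>x. \<bar>h r x - h (Suc r) x\<bar>)"
      using hdiff[of r] by (intro int) auto
    have "(\<integral>x. \<bar>h r x - h (Suc r) x\<bar> \<partial>M) \<le> (\<integral>x. (1/2)^r + 2^r * (h r x - h (Suc r) x)\<^sup>2 \<partial>M)"
      using i1 i2 am by (intro integral_mono) auto
    also have "\<dots> = (1/2)^r * measure M (space M) + 2^r * (\<integral>x. (h r x - h (Suc r) x)\<^sup>2 \<partial>M)"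
      using i2 by simp
    also have "\<dots> \<le> (1/2)^r * measure M (space M) + 2^r * (1/4)^r"
      unfolding h_def using s[OF t(2) t(3)] by (intro add_left_mono mult_left_mono) auto
    also have "(2::real)^r * (1/4)^r = (1/2)^r"
      by (simp flip: power_mult_distrib)
    finally show ?thesis by (simp add: algebra_simps)
  qed
  \<comment> \<open>The sum of the increments has a finite integral, hence is finite almost
    everywhere, and the sequence converges there.\<close>
  have "(\<integral>\<^sup>+ x. (\<Sum>r. ennreal \<bar>h r x - h (Suc r) x\<bar>) \<partial>M) = (\<Sum>r. \<integral>\<^sup>+ x. ennreal \<bar>h r x - h (Suc r) x\<bar> \<partial>M)"
    by (intro nn_integral_suminf) simp
  also have "\<dots> \<le> (\<Sum>r. ennreal ((1/2)^r * (measure M (space M) + 1)))"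
  proof (rule suminf_le)
    show "(\<integral>\<^sup>+ x. ennreal \<bar>h r x - h (Suc r) x\<bar> \<partial>M) \<le> ennreal ((1/2)^r * (measure M (space M) + 1))" for r
      using L1[of r] hdiff by (subst nn_integral_eq_integral) (auto intro!: int ennreal_leI)
  qed auto
  also have "\<dots> < \<infinity>"
    by (subst suminf_ennreal_eq[OF _ summable_sums]) (auto intro!: summable_mult2 summable_geometric)
  finally have "AE x in M. (\<Sum>r. ennreal \<bar>h r x - h (Suc r) x\<bar>) \<noteq> \<infinity>"
    by (intro nn_integral_PInf_AE) auto
  then have conv: "AE x in M. convergent (\<lambda>r. h r x)"
    by eventually_elim
      (auto intro!: convergent_if_summable_increments summable_suminf_not_top)
  \<comment> \<open>Clipping leaves genuine limits unchanged and keeps \<open>l\<close> within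
    [0, 1] on the null set of divergence, where \<open>lim\<close> is arbitrary.\<close>
  define l where "l x = max 0 (min 1 (lim (\<lambda>r. h r x)))" for x
  have "AE x in M. (\<lambda>r. h r x) \<longlonglongrightarrow> l x"
    using conv
  proof eventually_elim
    case (elim x)
    then have lim: "(\<lambda>r. h r x) \<longlonglongrightarrow> lim (\<lambda>r. h r x)"
      by (simp add: convergent_LIMSEQ_iff)
    moreover have "0 \<le> lim (\<lambda>r. h r x)" "lim (\<lambda>r. h r x) \<le> 1"
      using lim bnd[OF hK] by (auto intro: LIMSEQ_le_const LIMSEQ_le_const2)
    ultimately show ?case by (simp add: l_def)
  qed
  moreover have "l \<in> borel_measurable M"
    unfolding l_def by measurable
  ultimately show ?thesis
    using that[of h l] hK by (auto simp: l_def)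
qed

section \<open>Index densities\<close>

text \<open>\<open>f (i, _)\<close> is the density with respect to \<open>P\<close> of the mass that
  sample index \<open>i\<close> sends out. Mass is attached to indices and not to sample points, so
  the set is the same for all samples, including those with coinciding points. The bounds hold
  everywhere, which can be arranged by changing densities on null sets.\<close>

definition index_densities :: "nat \<Rightarrow> 'a measure \<Rightarrow> (nat \<times> 'a \<Rightarrow> real) set" where
  "index_densities N P = {f \<in> borel_measurable (count_space {1..N} \<Otimes>\<^sub>M P).
     (\<forall>z. 0 \<le> f z \<and> f z \<le> 1) \<and>
     (\<forall>i\<in>{1..N}. (\<integral>\<^sup>+ y. ennreal (f (i, y)) \<partial>P) = 1 / of_nat N) \<and>
     (\<forall>A\<in>sets P. (\<Sum>i\<in>{1..N}. \<integral>\<^sup>+ y. ennreal (f (i, y)) * indicator A y \<partial>P) = emeasure P A)}"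

lemma index_densities_bounds:
  assumes "f \<in> index_densities N P"
  shows "0 \<le> f z" "f z \<le> 1"
  using assms unfolding index_densities_def by blast+

text \<open>The transport cost if \<open>c (i, y)\<close> is the price of moving a unit of mass from
  sample \<open>i\<close> to \<open>y\<close>. It takes extended values, so it is defined before any
  moment is known to be finite.\<close>

definition index_cost :: "nat \<Rightarrow> 'a measure \<Rightarrow> (nat \<times> 'a \<Rightarrow> real) \<Rightarrow> (nat \<times> 'a \<Rightarrow> real) \<Rightarrow> ennreal" where
  "index_cost N P c f = (\<Sum>i\<in>{1..N}. \<integral>\<^sup>+ y. ennreal (c (i, y)) * ennreal (f (i, y)) \<partial>P)"

lemma measurable_count_space_slice:
  assumes "g \<in> measurable (count_space I \<Otimes>\<^sub>M P) B" "i \<in> I"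
  shows "(\<lambda>y. g (i, y)) \<in> measurable P B"
  using assms by (auto intro: measurable_compose_Pair1)

lemma (in sigma_finite_measure) nn_integral_count_space_pair:
  assumes "finite I" "g \<in> borel_measurable (count_space I \<Otimes>\<^sub>M M)"
  shows "(\<integral>\<^sup>+ z. g z \<partial>(count_space I \<Otimes>\<^sub>M M)) = (\<Sum>i\<in>I. \<integral>\<^sup>+ y. g (i, y) \<partial>M)"
  using assms nn_integral_fst[of g "count_space I"]
  by (simp add: nn_integral_count_space_finite)

lemma ennreal_midpoint:
  assumes "0 \<le> a" "0 \<le> b"
  shows "ennreal ((a + b) / 2) = inverse 2 * (ennreal a + ennreal b)"
proof -
  have "(a + b) / 2 = (1/2) * (a + b)" by simp
  also have "ennreal \<dots> = ennreal (1/2) * (ennreal a + ennreal b)"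
    using assms by (simp only: ennreal_mult ennreal_plus add_nonneg_nonneg)
  finally show ?thesis by simp
qed

lemma ennreal_half_add_self: "inverse 2 * (a + a) = (a :: ennreal)"
proof -
  have "ennreal (1/2) * ennreal 2 = ennreal (1/2 * 2)"
    by (rule ennreal_mult[symmetric]) auto
  then have "inverse 2 * 2 = (1 :: ennreal)" by simp
  then show ?thesis
    by (metis mult.assoc mult_1 mult_2)
qed

lemma nn_integral_midpoint:
  assumes "f \<in> borel_measurable M" "g \<in> borel_measurable M" "w \<in> borel_measurable M"
    and "\<And>x. 0 \<le> f x" "\<And>x. 0 \<le> g x"
  shows "(\<integral>\<^sup>+ y. w y * ennreal ((f y + g y) / 2) \<partial>M) =
    inverse 2 * ((\<integral>\<^sup>+ y. w y * ennreal (f y) \<partial>M) + (\<integral>\<^sup>+ y. w y * ennreal (g y) \<partial>M))"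
proof -
  have "(\<integral>\<^sup>+ y. w y * ennreal ((f y + g y) / 2) \<partial>M) =
      (\<integral>\<^sup>+ y. inverse 2 * (w y * ennreal (f y) + w y * ennreal (g y)) \<partial>M)"
    using assms by (intro nn_integral_cong) (simp add: ennreal_midpoint algebra_simps)
  then show ?thesis
    using assms by (simp add: nn_integral_cmult nn_integral_add)
qed

text \<open>All constraints and the cost are affine in \<open>f\<close>. Hence sublevel sets of the
  cost are midpoint-convex, as the convergence lemma requires.\<close>

lemma index_densities_midpoint:
  assumes fg: "f \<in> index_densities N P" "g \<in> index_densities N P"
    and c: "c \<in> borel_measurable (count_space {1..N} \<Otimes>\<^sub>M P)"
  shows "(\<lambda>z. (f z + g z) / 2) \<in> index_densities N P"
    and "index_cost N P c (\<lambda>z. (f z + g z) / 2) =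
      inverse 2 * (index_cost N P c f + index_cost N P c g)"
proof -
  have f: "f \<in> borel_measurable (count_space {1..N} \<Otimes>\<^sub>M P)"
    and g: "g \<in> borel_measurable (count_space {1..N} \<Otimes>\<^sub>M P)"
    and f0: "\<And>z. 0 \<le> f z" and f1: "\<And>z. f z \<le> 1" and g0: "\<And>z. 0 \<le> g z" and g1: "\<And>z. g z \<le> 1"
    using fg by (auto simp: index_densities_def)
  note m [measurable] = measurable_count_space_slice[OF f] measurable_count_space_slice[OF g]
    measurable_count_space_slice[OF c]
  have mid: "(\<integral>\<^sup>+ y. w y * ennreal ((f (i, y) + g (i, y)) / 2) \<partial>P) =
    inverse 2 * ((\<integral>\<^sup>+ y. w y * ennreal (f (i, y)) \<partial>P) + (\<integral>\<^sup>+ y. w y * ennreal (g (i, y)) \<partial>P))"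
    if "i \<in> {1..N}" "w \<in> borel_measurable P" for i w
    using that f0 g0 by (intro nn_integral_midpoint m) auto
  show "index_cost N P c (\<lambda>z. (f z + g z) / 2) =
      inverse 2 * (index_cost N P c f + index_cost N P c g)"
    unfolding index_cost_def sum.distrib[symmetric] sum_distrib_left
    by (intro sum.cong refl mid) auto
  have "(\<integral>\<^sup>+ y. ennreal ((f (i, y) + g (i, y)) / 2) \<partial>P) = 1 / of_nat N" if i: "i \<in> {1..N}" for i
    using mid[OF i, of "\<lambda>_. 1"] fg i by (simp add: index_densities_def ennreal_half_add_self)
  moreover have "(\<Sum>i\<in>{1..N}. \<integral>\<^sup>+ y. ennreal ((f (i, y) + g (i, y)) / 2) * indicator A y \<partial>P) = emeasure P A"
    if A: "A \<in> sets P" for A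
  proof -
    have "(\<Sum>i\<in>{1..N}. \<integral>\<^sup>+ y. ennreal ((f (i, y) + g (i, y)) / 2) * indicator A y \<partial>P) =
        (\<Sum>i\<in>{1..N}. inverse 2 * ((\<integral>\<^sup>+ y. ennreal (f (i, y)) * indicator A y \<partial>P) +
          (\<integral>\<^sup>+ y. ennreal (g (i, y)) * indicator A y \<partial>P)))"
      using mid[of _ "indicator A"] A by (intro sum.cong) (auto simp: mult.commute)
    also have "\<dots> = inverse 2 * ((\<Sum>i\<in>{1..N}. \<integral>\<^sup>+ y. ennreal (f (i, y)) * indicator A y \<partial>P) +
          (\<Sum>i\<in>{1..N}. \<integral>\<^sup>+ y. ennreal (g (i, y)) * indicator A y \<partial>P))"
      unfolding sum_distrib_left[symmetric] sum.distrib ..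
    also have "\<dots> = emeasure P A"
      using fg A by (simp add: index_densities_def ennreal_half_add_self)
    finally show ?thesis .
  qed
  moreover have "(f z + g z) / 2 \<le> 1" for z
    using f1[of z] g1[of z] by simp
  ultimately show "(\<lambda>z. (f z + g z) / 2) \<in> index_densities N P"
    using f g f0 g0 by (auto simp: index_densities_def)
qed

text \<open>The densities of cost at most \<open>t\<close> plus a vanishing slack form decreasing
  midpoint-convex sets, so suitable members converge almost everywhere. The constraints survive the
  limit by dominated convergence; the cost function may be unbounded, so Fatou's lemma is used for
  the cost.\<close>

lemma index_density_attained:
  assumes P: "prob_space P"
    and c [measurable]: "c \<in> borel_measurable (count_space {1..N} \<Otimes>\<^sub>M P)" and c0: "\<And>z. 0 \<le> c z"
    and t: "\<And>j. \<exists>f\<in>index_densities N P. index_cost N P c f \<le> t + ennreal (1 / real (Suc j))"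
  shows "\<exists>f\<in>index_densities N P. index_cost N P c f \<le> t"
proof -
  interpret P: prob_space P by fact
  \<comment> \<open>All indices are treated in one finite measure space of total mass
    \<open>N\<close>, so that a single limit serves them together.\<close>
  define R where "R = count_space {1..N} \<Otimes>\<^sub>M P"
  have measR: "f \<in> borel_measurable R" if "f \<in> index_densities N P" for f
    using that by (simp add: R_def index_densities_def)
  have [measurable]: "c \<in> borel_measurable R"
    using c by (simp add: R_def)
  have cost: "index_cost N P c f = (\<integral>\<^sup>+ z. ennreal (c z * f z) \<partial>R)" if "f \<in> borel_measurable R" for f
  proof -
    have [measurable]: "f \<in> borel_measurable (count_space {1..N} \<Otimes>\<^sub>M P)"
      using that by (simp add: R_def)
    show ?thesis
      unfolding R_def index_cost_def
      by (subst P.nn_integral_count_space_pair) (simp_all add: ennreal_mult' c0 del: One_nat_def)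
  qed
  have "emeasure R (space R) = (\<integral>\<^sup>+ z. 1 \<partial>R)" by simp
  also have "\<dots> = of_nat N"
    unfolding R_def by (subst P.nn_integral_count_space_pair) (auto simp: P.emeasure_space_1)
  finally interpret R: finite_measure R
    by (intro finite_measureI) simp
  define K where "K j = {f \<in> index_densities N P. index_cost N P c f \<le> t + ennreal (1 / real (Suc j))}" for j
  obtain h l where hl: "\<And>j. h j \<in> K j" "l \<in> borel_measurable R" "\<And>z. 0 \<le> l z \<and> l z \<le> 1"
    "AE z in R. (\<lambda>j. h j z) \<longlonglongrightarrow> l z"
  proof (rule R.midpoint_convex_sequence_converges[of K])
    show "K j \<noteq> {}" for j using t[of j] by (auto simp: K_def)
    show "decseq K"
    proof (rule decseq_SucI, rule subsetI)
      fix j f assume "f \<in> K (Suc j)"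
      moreover have "t + ennreal (1 / real (Suc (Suc j))) \<le> t + ennreal (1 / real (Suc j))"
        by (intro add_left_mono ennreal_leI frac_le) auto
      ultimately show "f \<in> K j"
        unfolding K_def by (blast intro: order.trans)
    qed
    show "g \<in> borel_measurable R" if "g \<in> K j" for j g
      using that measR by (auto simp: K_def)
    show "0 \<le> g z \<and> g z \<le> 1" if "g \<in> K j" for j g z
      using that index_densities_bounds[of g N P z] by (simp add: K_def)
    show "(\<lambda>x. (f x + g x) / 2) \<in> K j" if "f \<in> K j" "g \<in> K j" for j f g
    proof -
      let ?s = "t + ennreal (1 / real (Suc j))"
      have "inverse 2 * (index_cost N P c f + index_cost N P c g) \<le> inverse 2 * (?s + ?s)"
        using that unfolding K_def by (intro mult_left_mono add_mono) auto
      then show ?thesis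
        using that index_densities_midpoint[OF _ _ c, of f g]
        by (simp add: K_def ennreal_half_add_self)
    qed
  next
    fix h l
    assume "\<And>j. h j \<in> K j" "l \<in> borel_measurable R" "\<And>z. 0 \<le> l z \<and> l z \<le> 1"
      "AE z in R. (\<lambda>j. h j z) \<longlonglongrightarrow> l z"
    then show thesis by (rule that)
  qed
  have hID: "h j \<in> index_densities N P" for j
    using hl(1)[of j] by (simp add: K_def)
  note [measurable] = measR[OF hID] hl(2)
  have hm: "h j \<in> borel_measurable (count_space {1..N} \<Otimes>\<^sub>M P)"
    and lm: "l \<in> borel_measurable (count_space {1..N} \<Otimes>\<^sub>M P)" for j
    using measR[OF hID] hl(2) by (auto simp: R_def)
  note m [measurable] = measurable_count_space_slice[OF hm] measurable_count_space_slice[OF lm]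
  have h01: "0 \<le> h j z \<and> h j z \<le> 1" for j z
    using index_densities_bounds[OF hID] by simp
  \<comment> \<open>A nonempty set of indices is never null for the counting measure, so the almost
    sure limit holds for every index.\<close>
  have slice: "AE y in P. (\<lambda>j. h j (i, y)) \<longlonglongrightarrow> l (i, y)" if "i \<in> {1..N}" for i
  proof -
    interpret pair_sigma_finite "count_space {1..N}" P
      by (intro pair_sigma_finite.intro P.sigma_finite_measure_axioms
          sigma_finite_measure_count_space_finite) simp
    have "AE i in count_space {1..N}. AE y in P. (\<lambda>j. h j (i, y)) \<longlonglongrightarrow> l (i, y)"
      using hl(4) unfolding R_def by (rule AE_pair)
    then show ?thesis using that by (simp add: AE_count_space)
  qed
  have lim: "(\<lambda>j. \<integral>\<^sup>+ y. ennreal (h j (i, y)) * indicator A y \<partial>P) \<longlonglongrightarrow>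
      (\<integral>\<^sup>+ y. ennreal (l (i, y)) * indicator A y \<partial>P)" if i: "i \<in> {1..N}" and A: "A \<in> sets P" for i A
  proof (rule nn_integral_dominated_convergence[where w = "\<lambda>_. 1"])
    show "AE y in P. (\<lambda>j. ennreal (h j (i, y)) * indicator A y) \<longlonglongrightarrow> ennreal (l (i, y)) * indicator A y"
      using slice[OF i] by eventually_elim (auto simp: indicator_def intro!: tendsto_ennrealI)
    show "AE y in P. ennreal (h j (i, y)) * indicator A y \<le> 1" for j
      using h01[of j] by (auto simp: indicator_def)
  qed (use i A in \<open>auto simp: P.emeasure_space_1\<close>)
  have "l \<in> index_densities N P"
    unfolding index_densities_def
  proof (intro CollectI conjI ballI lm allI)
    fix i assume i: "i \<in> {1..N}"
    have ind: "ennreal (u y) * indicator (space P) y = ennreal (u y)" if "y \<in> space P" for u y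
      using that by simp
    have "(\<lambda>j. \<integral>\<^sup>+ y. ennreal (h j (i, y)) \<partial>P) \<longlonglongrightarrow> (\<integral>\<^sup>+ y. ennreal (l (i, y)) \<partial>P)"
      using lim[OF i sets.top] by (simp add: ind cong: nn_integral_cong)
    moreover have "(\<integral>\<^sup>+ y. ennreal (h j (i, y)) \<partial>P) = 1 / of_nat N" for j
      using hID[of j] i by (simp add: index_densities_def)
    ultimately show "(\<integral>\<^sup>+ y. ennreal (l (i, y)) \<partial>P) = 1 / of_nat N"
      by (simp add: LIMSEQ_const_iff)
  next
    fix A assume A: "A \<in> sets P"
    have "(\<lambda>j. \<Sum>i\<in>{1..N}. \<integral>\<^sup>+ y. ennreal (h j (i, y)) * indicator A y \<partial>P) \<longlonglongrightarrow>
        (\<Sum>i\<in>{1..N}. \<integral>\<^sup>+ y. ennreal (l (i, y)) * indicator A y \<partial>P)"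
      using lim A by (intro tendsto_sum) auto
    moreover have "(\<Sum>i\<in>{1..N}. \<integral>\<^sup>+ y. ennreal (h j (i, y)) * indicator A y \<partial>P) = emeasure P A" for j
      using hID[of j] A by (simp add: index_densities_def)
    ultimately show "(\<Sum>i\<in>{1..N}. \<integral>\<^sup>+ y. ennreal (l (i, y)) * indicator A y \<partial>P) = emeasure P A"
      by (simp add: LIMSEQ_const_iff)
  qed (use hl(3) in auto)
  moreover have "index_cost N P c l \<le> t"
  proof -
    \<comment> \<open>Along the almost sure limit the integrand is the limit inferior of the
      integrands of the \<open>h j\<close>, which is the form for Fatou's lemma.\<close>
    have "index_cost N P c l = (\<integral>\<^sup>+ z. liminf (\<lambda>j. ennreal (c z * h j z)) \<partial>R)"
      unfolding cost[OF hl(2)]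
    proof (rule nn_integral_cong_AE)
      show "AE z in R. ennreal (c z * l z) = liminf (\<lambda>j. ennreal (c z * h j z))"
        using hl(4)
      proof eventually_elim
        case (elim z)
        then have "(\<lambda>j. ennreal (c z * h j z)) \<longlonglongrightarrow> ennreal (c z * l z)"
          by (intro tendsto_ennrealI tendsto_mult tendsto_const)
        then show ?case
          by (intro lim_imp_Liminf[symmetric]) auto
      qed
    qed
    also have "\<dots> \<le> liminf (\<lambda>j. \<integral>\<^sup>+ z. ennreal (c z * h j z) \<partial>R)"
      by (intro nn_integral_liminf) measurable
    also have "\<dots> \<le> liminf (\<lambda>j. t + ennreal (1 / real (Suc j)))"
      using hl(1) by (intro Liminf_mono always_eventually allI)
        (auto simp: K_def cost[OF measR, symmetric])
    also have "\<dots> = t"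
    proof (rule lim_imp_Liminf)
      have "(\<lambda>j. t + ennreal (1 / real (Suc j))) \<longlonglongrightarrow> t + ennreal 0"
        by (intro tendsto_add tendsto_const tendsto_ennrealI LIMSEQ_Suc[OF lim_1_over_n])
      then show "(\<lambda>j. t + ennreal (1 / real (Suc j))) \<longlonglongrightarrow> t" by simp
    qed simp
    finally show ?thesis .
  qed
  ultimately show ?thesis by blast
qed

section \<open>Couplings of an empirical measure\<close>

text \<open>Tested on the set \<open>A\<close> where \<open>f\<close> exceeds 1: were
  \<open>A\<close> not null, its mass under the density would exceed its mass under
  \<open>M\<close>, strictly because the latter is finite.\<close>

lemma (in finite_measure) AE_density_le_one:
  assumes f [measurable]: "f \<in> borel_measurable M"
    and le: "\<And>A. A \<in> sets M \<Longrightarrow> emeasure (density M f) A \<le> emeasure M A"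
  shows "AE x in M. f x \<le> 1"
proof (rule ccontr)
  assume *: "\<not> (AE x in M. f x \<le> 1)"
  define A where "A = {x \<in> space M. 1 < f x}"
  have A [measurable]: "A \<in> sets M" by (simp add: A_def)
  have "(\<integral>\<^sup>+ x. indicator A x \<partial>M) < (\<integral>\<^sup>+ x. f x * indicator A x \<partial>M)"
  proof (rule nn_integral_less)
    show "\<not> (AE x in M. f x * indicator A x \<le> indicator A x)"
    proof
      assume "AE x in M. f x * indicator A x \<le> indicator A x"
      then have "AE x in M. f x \<le> 1"
        using AE_space by eventually_elim (auto simp: A_def indicator_def of_bool_def split: if_splits)
      with * show False by simp
    qed
    show "(\<integral>\<^sup>+ x. indicator A x \<partial>M) \<noteq> \<infinity>"
      by (simp add: emeasure_eq_measure)
  qed (auto simp: A_def indicator_def less_imp_le)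
  also have "\<dots> = emeasure (density M f) A"
    by (simp add: emeasure_density)
  finally show False
    using le[OF A] by simp
qed

lemma inverse_of_nat_mult_of_nat:
  assumes "0 < k"
  shows "1 / of_nat k * of_nat k = (1 :: ennreal)"
proof -
  have "ennreal (1 / real k) * ennreal (real k) = ennreal (1 / real k * real k)"
    by (rule ennreal_mult[symmetric]) auto
  then show ?thesis
    using assms by (simp add: divide_ennreal[symmetric] ennreal_of_nat_eq_real_of_nat)
qed

lemma sets_borel_alg_mtopology_square:
  assumes "separable_space (mtopology_of m)"
  shows "sets (borel_alg (prod_topology (mtopology_of m) (mtopology_of m))) = sets (mborel m \<Otimes>\<^sub>M mborel m)"
  using assms by (intro sets_borel_alg_prod_topology separable_metric_imp_second_countable)

text \<open>Continuity gives measurability for the Borel algebra of the square; separability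
  identifies it with the product \<sigma>-algebra.\<close>

lemma borel_measurable_mdist_pair:
  assumes "separable_space (mtopology_of m)"
  shows "(\<lambda>z. mdist m (fst z) (snd z)) \<in> borel_measurable (mborel m \<Otimes>\<^sub>M mborel m)"
  unfolding measurable_cong_sets[OF sets_borel_alg_mtopology_square[OF assms] refl, symmetric]
  by (intro continuous_map_borel_measurable continuous_map_mdist continuous_map_fst continuous_map_snd)

text \<open>The target law and the sample size are fixed. The sample stays a variable of the lemmas,
  since the minimal cost is studied as a function of it.\<close>

locale empirical_coupling = prob_space P for P :: "'a measure" +
  fixes m :: "'a metric" and N :: nat and p :: real
  assumes separable: "separable_space (mtopology_of m)"
    and sets_P [measurable_cong]: "sets P = sets (mborel m)"
    and N_pos: "1 \<le> N" and p_ge_1: "1 \<le> p"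
begin

abbreviation "B \<equiv> mborel m"

lemma space_P [simp]: "space P = mspace m"
  using sets_eq_imp_space_eq[OF sets_P] by simp

lemmas sets_transport = sets_borel_alg_mtopology_square[OF separable]

lemmas measurable_mdist_pair [measurable] = borel_measurable_mdist_pair[OF separable]

lemma measurable_mdist [measurable]: "a \<in> mspace m \<Longrightarrow> mdist m a \<in> borel_measurable B"
  by (intro continuous_map_borel_measurable continuous_on_mdist)

lemma singleton_sets: "a \<in> mspace m \<Longrightarrow> {a} \<in> sets B"
proof -
  assume a: "a \<in> mspace m"
  have "{a} = {y \<in> space B. mdist m a y = 0}"
    using a by auto
  also have "\<dots> \<in> sets B"
    using a by measurable
  finally show ?thesis .
qed

definition cost :: "(nat \<Rightarrow> 'a) \<Rightarrow> nat \<times> 'a \<Rightarrow> real" where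
  "cost x z = mdist m (x (fst z)) (snd z) powr p"

lemma cost_nonneg: "0 \<le> cost x z"
  by (simp add: cost_def)

lemma measurable_cost:
  assumes "x \<in> {1..N} \<rightarrow> mspace m"
  shows "cost x \<in> borel_measurable (count_space {1..N} \<Otimes>\<^sub>M P)"
proof (rule measurable_pair_measure_countable1)
  fix i assume "i \<in> {1..N}"
  then have [measurable]: "mdist m (x i) \<in> borel_measurable B"
    using assms by (intro measurable_mdist) auto
  show "(\<lambda>y. cost x (i, y)) \<in> borel_measurable P"
    unfolding cost_def by simp
qed simp

lemma couplingsD:
  assumes "\<pi> \<in> couplings m Q P"
  shows "prob_space \<pi>" "sets \<pi> = sets (B \<Otimes>\<^sub>M B)" "distr \<pi> B fst = Q" "distr \<pi> B snd = P"
  using assms by (auto simp: couplings_def transport_plans_def borel_probs_def sets_transport)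

text \<open>The coupling is the image of the measure with density \<open>f\<close> under the map
  from \<open>(i, y)\<close> to \<open>(x i, y)\<close>. The mass \<open>1 / N\<close> of each index
  gives the empirical first marginal, and the sum over indices gives the second.\<close>

lemma coupling_of_index_density:
  assumes x: "x \<in> {1..N} \<rightarrow> mspace m" and f: "f \<in> index_densities N P"
  shows "\<exists>\<pi>\<in>couplings m (empirical B N x) P.
    (\<integral>\<^sup>+ z. ennreal (mdist m (fst z) (snd z) powr p) \<partial>\<pi>) = index_cost N P (cost x) f"
proof -
  define R where "R = count_space {1..N} \<Otimes>\<^sub>M P"
  have [measurable]: "f \<in> borel_measurable R"
    using f by (simp add: index_densities_def R_def)
  have fm: "(\<lambda>y. f (i, y)) \<in> borel_measurable P" if "i \<in> {1..N}" for i
    using f that by (intro measurable_count_space_slice[of f]) (auto simp: index_densities_def)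
  define T where "T z = (x (fst z), snd z)" for z :: "nat \<times> 'a"
  have xm: "x \<in> measurable (count_space {1..N}) B"
    using x by simp
  have T [measurable]: "T \<in> measurable R (B \<Otimes>\<^sub>M B)"
    unfolding T_def R_def
    by (intro measurable_Pair measurable_compose[OF measurable_fst xm]) simp_all
  define \<pi> where "\<pi> = distr (density R f) (B \<Otimes>\<^sub>M B) T"
  have sets_\<pi> [measurable_cong]: "sets \<pi> = sets (B \<Otimes>\<^sub>M B)"
    by (simp add: \<pi>_def)
  \<comment> \<open>This change of variables yields both marginals and the cost, by inserting the
    respective integrand.\<close>
  have int: "(\<integral>\<^sup>+ z. g z \<partial>\<pi>) = (\<Sum>i\<in>{1..N}. \<integral>\<^sup>+ y. ennreal (f (i, y)) * g (x i, y) \<partial>P)"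
    if g [measurable]: "g \<in> borel_measurable (B \<Otimes>\<^sub>M B)" for g
  proof -
    have "(\<integral>\<^sup>+ z. g z \<partial>\<pi>) = (\<integral>\<^sup>+ z. ennreal (f z) * g (T z) \<partial>R)"
      unfolding \<pi>_def by (simp add: nn_integral_distr nn_integral_density)
    also have "\<dots> = (\<Sum>i\<in>{1..N}. \<integral>\<^sup>+ y. ennreal (f (i, y)) * g (T (i, y)) \<partial>P)"
      unfolding R_def
      by (rule nn_integral_count_space_pair) (simp_all flip: R_def One_nat_def)
    finally show ?thesis by (simp add: T_def)
  qed
  have fst: "distr \<pi> B fst = empirical B N x"
  proof (rule measure_eqI)
    fix A assume "A \<in> sets (distr \<pi> B fst)"
    then have A [measurable]: "A \<in> sets B" by simp
    have "emeasure (distr \<pi> B fst) A = (\<integral>\<^sup>+ z. indicator A z \<partial>distr \<pi> B fst)"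
      by simp
    also have "\<dots> = (\<integral>\<^sup>+ z. indicator A (fst z) \<partial>\<pi>)"
      by (rule nn_integral_distr) measurable
    also have "\<dots> = (\<Sum>i\<in>{1..N}. \<integral>\<^sup>+ y. ennreal (f (i, y)) * indicator A (x i) \<partial>P)"
      by (subst int) simp_all
    also have "\<dots> = (\<Sum>i\<in>{1..N}. 1 / of_nat N * indicator A (x i))"
    proof (rule sum.cong[OF refl])
      fix i assume i: "i \<in> {1..N}"
      show "(\<integral>\<^sup>+ y. ennreal (f (i, y)) * indicator A (x i) \<partial>P) = 1 / of_nat N * indicator A (x i)"
        using f i fm[OF i] by (simp add: nn_integral_multc index_densities_def)
    qed
    also have "\<dots> = emeasure (empirical B N x) A"
      by (simp add: emeasure_empirical A sum_distrib_left)
    finally show "emeasure (distr \<pi> B fst) A = emeasure (empirical B N x) A" .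
  qed simp
  have snd: "distr \<pi> B snd = P"
  proof (rule measure_eqI)
    fix A assume "A \<in> sets (distr \<pi> B snd)"
    then have A [measurable]: "A \<in> sets B" by simp
    have "emeasure (distr \<pi> B snd) A = (\<integral>\<^sup>+ z. indicator A z \<partial>distr \<pi> B snd)"
      by simp
    also have "\<dots> = (\<integral>\<^sup>+ z. indicator A (snd z) \<partial>\<pi>)"
      by (rule nn_integral_distr) measurable
    also have "\<dots> = (\<Sum>i\<in>{1..N}. \<integral>\<^sup>+ y. ennreal (f (i, y)) * indicator A y \<partial>P)"
      by (subst int) simp_all
    also have "\<dots> = emeasure P A"
      using f A sets_P by (auto simp: index_densities_def)
    finally show "emeasure (distr \<pi> B snd) A = emeasure P A" .
  qed (simp add: sets_P)
  have "prob_space (distr \<pi> B snd)"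
    unfolding snd by (rule prob_space_axioms)
  then have "prob_space \<pi>"
    by (rule prob_space_distrD[rotated]) measurable
  then have "\<pi> \<in> couplings m (empirical B N x) P"
    using fst snd sets_\<pi> by (simp add: couplings_def transport_plans_def borel_probs_def sets_transport)
  moreover have "(\<integral>\<^sup>+ z. ennreal (mdist m (fst z) (snd z) powr p) \<partial>\<pi>) = index_cost N P (cost x) f"
    by (subst int) (simp_all add: index_cost_def cost_def mult.commute)
  ultimately show ?thesis by blast
qed

text \<open>The coupling is split according to its first coordinate, which is almost surely a sample
  point. The second marginals of the pieces are dominated by \<open>P\<close>, and their
  Radon-Nikodym derivatives are the index densities.\<close>

lemma index_density_of_coupling:
  assumes x: "x \<in> {1..N} \<rightarrow> mspace m" and \<pi>: "\<pi> \<in> couplings m (empirical B N x) P"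
  shows "\<exists>f\<in>index_densities N P.
    index_cost N P (cost x) f = (\<integral>\<^sup>+ z. ennreal (mdist m (fst z) (snd z) powr p) \<partial>\<pi>)"
proof -
  note \<pi>D = couplingsD[OF \<pi>]
  note [measurable_cong] = \<pi>D(2)
  have xi: "x i \<in> mspace m" if "i \<in> {1..N}" for i
    using x that by auto
  \<comment> \<open>Several indices may carry the same sample point. Its mass,
    \<open>k i / N\<close>, is shared equally among them, so that each index receives
    \<open>1 / N\<close>.\<close>
  define k where "k i = card {j \<in> {1..N}. x j = x i}" for i
  have k_pos: "0 < k i" if "i \<in> {1..N}" for i
    using that by (auto simp: k_def card_gt_0_iff)
  define J :: "nat \<Rightarrow> 'a \<times> 'a \<Rightarrow> ennreal" where "J i z = 1 / of_nat (k i) * indicator {x i} (fst z)" for i z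
  have J [measurable]: "J i \<in> borel_measurable (B \<Otimes>\<^sub>M B)" if "i \<in> {1..N}" for i
  proof -
    have [measurable]: "{x i} \<in> sets B" using xi[OF that] by (rule singleton_sets)
    show ?thesis unfolding J_def by measurable
  qed
  have J_le_1: "J i z \<le> 1" if "i \<in> {1..N}" for i z
  proof -
    have "(1::ennreal) \<le> of_nat (k i)"
      using of_nat_mono[of 1 "k i", where 'a = ennreal] k_pos[OF that] by simp
    then have "1 / of_nat (k i) * (1::ennreal) \<le> 1 / of_nat (k i) * of_nat (k i)"
      by (rule mult_left_mono) simp
    then show ?thesis
      using inverse_of_nat_mult_of_nat[OF k_pos[OF that]] by (auto simp: J_def indicator_def)
  qed
  \<comment> \<open>The weights form a partition of unity over the sample points, so the pieces add
    up to the whole coupling.\<close>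
  have sum_J: "(\<Sum>i\<in>{1..N}. J i z) = 1" if z: "fst z \<in> x ` {1..N}" for z
  proof -
    obtain j where j: "j \<in> {1..N}" "fst z = x j" using z by auto
    have "J i z = (if x i = x j then 1 / of_nat (k j) else 0)" for i
      by (auto simp: J_def j k_def)
    then have "(\<Sum>i\<in>{1..N}. J i z) = (\<Sum>i\<in>{i\<in>{1..N}. x i = x j}. 1 / of_nat (k j))"
      by (simp only: sum.inter_filter finite_atLeastAtMost)
    also have "\<dots> = 1"
      using inverse_of_nat_mult_of_nat[OF k_pos[OF j(1)]] by (simp add: k_def mult.commute)
    finally show ?thesis .
  qed
  have fin_img: "x ` {1..N} \<in> sets B"
  proof -
    have "(\<Union>i\<in>{1..N}. {x i}) \<in> sets B"
      using xi by (intro sets.finite_UN singleton_sets) auto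
    also have "(\<Union>i\<in>{1..N}. {x i}) = x ` {1..N}" by blast
    finally show ?thesis .
  qed
  have supp: "AE z in \<pi>. fst z \<in> x ` {1..N}"
  proof -
    have compl: "mspace m - x ` {1..N} \<in> sets B"
      using sets.compl_sets[OF fin_img] by simp
    then have "emeasure (empirical B N x) (mspace m - x ` {1..N}) = 0"
      by (simp add: emeasure_empirical indicator_def del: One_nat_def)
    then have "AE y in empirical B N x. y \<in> x ` {1..N}"
      using compl by (intro AE_I[of _ _ "mspace m - x ` {1..N}"]) auto
    then show ?thesis
      unfolding \<pi>D(3)[symmetric] by (rule AE_distrD[rotated]) measurable
  qed
  define \<nu> where "\<nu> i = distr (density \<pi> (J i)) B snd" for i
  have int_\<nu>: "(\<integral>\<^sup>+ y. g y \<partial>\<nu> i) = (\<integral>\<^sup>+ z. J i z * g (snd z) \<partial>\<pi>)"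
    if i: "i \<in> {1..N}" and g [measurable]: "g \<in> borel_measurable B" for i g
  proof -
    note [measurable] = J[OF i]
    show ?thesis
      unfolding \<nu>_def by (simp add: nn_integral_distr nn_integral_density)
  qed
  have int_snd: "(\<integral>\<^sup>+ z. g (snd z) \<partial>\<pi>) = (\<integral>\<^sup>+ y. g y \<partial>P)" if [measurable]: "g \<in> borel_measurable B" for g
    unfolding \<pi>D(4)[symmetric] by (simp add: nn_integral_distr)
  have int_fst: "(\<integral>\<^sup>+ z. g (fst z) \<partial>\<pi>) = (\<integral>\<^sup>+ y. g y \<partial>empirical B N x)" if [measurable]: "g \<in> borel_measurable B" for g
    unfolding \<pi>D(3)[symmetric] by (simp add: nn_integral_distr)
  have sets_\<nu>: "sets (\<nu> i) = sets P" for i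
    by (simp add: \<nu>_def sets_P)
  \<comment> \<open>Domination by \<open>P\<close> has two uses: it gives absolute continuity, hence
    a density, and it bounds this density by 1 almost everywhere.\<close>
  have \<nu>_le: "emeasure (\<nu> i) A \<le> emeasure P A" if i: "i \<in> {1..N}" and A: "A \<in> sets P" for i A
  proof -
    have [measurable]: "A \<in> sets B" using A sets_P by simp
    have "emeasure (\<nu> i) A = (\<integral>\<^sup>+ y. indicator A y \<partial>\<nu> i)"
      using A sets_\<nu> by simp
    also have "\<dots> = (\<integral>\<^sup>+ z. J i z * indicator A (snd z) \<partial>\<pi>)"
      by (rule int_\<nu>[OF i]) measurable
    also have "\<dots> \<le> (\<integral>\<^sup>+ z. indicator A (snd z) \<partial>\<pi>)"
      using J_le_1[OF i] by (intro nn_integral_mono) (simp add: indicator_def)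
    also have "\<dots> = emeasure P A"
      using A by (subst int_snd) auto
    finally show ?thesis .
  qed
  define F where "F i = RN_deriv P (\<nu> i)" for i
  have F [measurable]: "F i \<in> borel_measurable P" for i
    by (simp add: F_def)
  have dens: "density P (F i) = \<nu> i" if i: "i \<in> {1..N}" for i
    unfolding F_def
  proof (rule density_RN_deriv)
    show "absolutely_continuous P (\<nu> i)"
      using \<nu>_le[OF i] by (fastforce simp: absolutely_continuous_def null_sets_def sets_\<nu>)
  qed (rule sets_\<nu>)
  \<comment> \<open>Truncation at 1 makes the bound hold everywhere and the value real; it changes
    \<open>F i\<close> only on a null set.\<close>
  define f where "f z = enn2real (min 1 (F (fst z) (snd z)))" for z
  have f_eq: "ennreal (f (i, y)) = min 1 (F i y)" for i y
    unfolding f_def fst_conv snd_conv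
    by (intro ennreal_enn2real le_less_trans[OF min.cobounded1]) simp
  have f_AE: "AE y in P. ennreal (f (i, y)) = F i y" if i: "i \<in> {1..N}" for i
  proof -
    have "AE y in P. F i y \<le> 1"
      using \<nu>_le[OF i] by (intro AE_density_le_one) (simp_all add: dens[OF i])
    then show ?thesis
      by eventually_elim (simp add: f_eq)
  qed
  have int_f: "(\<integral>\<^sup>+ y. ennreal (f (i, y)) * g y \<partial>P) = (\<integral>\<^sup>+ z. J i z * g (snd z) \<partial>\<pi>)"
    if i: "i \<in> {1..N}" and g [measurable]: "g \<in> borel_measurable B" for i g
  proof -
    have "(\<integral>\<^sup>+ y. ennreal (f (i, y)) * g y \<partial>P) = (\<integral>\<^sup>+ y. F i y * g y \<partial>P)"
      using f_AE[OF i] by (intro nn_integral_cong_AE) (auto elim: eventually_mono)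
    also have "\<dots> = (\<integral>\<^sup>+ y. g y \<partial>density P (F i))"
      by (simp add: nn_integral_density)
    finally show ?thesis
      by (simp add: dens[OF i] int_\<nu>[OF i g])
  qed
  have sum_int: "(\<Sum>i\<in>{1..N}. \<integral>\<^sup>+ z. J i z * g z \<partial>\<pi>) = (\<integral>\<^sup>+ z. g z \<partial>\<pi>)"
    if [measurable]: "g \<in> borel_measurable (B \<Otimes>\<^sub>M B)" for g
  proof -
    have "(\<Sum>i\<in>{1..N}. \<integral>\<^sup>+ z. J i z * g z \<partial>\<pi>) = (\<integral>\<^sup>+ z. (\<Sum>i\<in>{1..N}. J i z * g z) \<partial>\<pi>)"
      by (rule nn_integral_sum[symmetric]) measurable
    also have "\<dots> = (\<integral>\<^sup>+ z. g z \<partial>\<pi>)"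
      using supp by (intro nn_integral_cong_AE)
        (auto elim!: eventually_mono simp: sum_distrib_right[symmetric] sum_J simp del: One_nat_def)
    finally show ?thesis .
  qed
  have "f \<in> index_densities N P"
    unfolding index_densities_def
  proof (intro CollectI conjI ballI allI)
    show "f \<in> borel_measurable (count_space {1..N} \<Otimes>\<^sub>M P)"
      by (rule measurable_pair_measure_countable1) (simp_all add: f_def)
    show "0 \<le> f z" for z by (simp add: f_def)
    show "f z \<le> 1" for z
      using enn2real_mono[of "min 1 (F (fst z) (snd z))" 1] by (simp add: f_def)
  next
    fix i assume i: "i \<in> {1..N}"
    have [measurable]: "{x i} \<in> sets B" using xi[OF i] by (rule singleton_sets)
    have "(\<integral>\<^sup>+ y. ennreal (f (i, y)) \<partial>P) = (\<integral>\<^sup>+ z. J i z \<partial>\<pi>)"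
      using int_f[OF i, of "\<lambda>_. 1"] by simp
    also have "\<dots> = (\<integral>\<^sup>+ y. 1 / of_nat (k i) * indicator {x i} y \<partial>empirical B N x)"
      unfolding J_def by (rule int_fst) measurable
    also have "\<dots> = 1 / of_nat (k i) * emeasure (empirical B N x) {x i}"
      by (rule nn_integral_cmult_indicator) simp
    also have "emeasure (empirical B N x) {x i} = 1 / of_nat N * of_nat (k i)"
    proof -
      have "(\<Sum>j\<in>{1..N}. indicator {x i} (x j)) = (of_nat (k i) :: ennreal)"
        by (simp add: k_def indicator_def sum.If_cases Int_def conj_commute)
      then show ?thesis
        by (simp add: emeasure_empirical)
    qed
    also have "1 / of_nat (k i) * (1 / of_nat N * of_nat (k i)) = (1 / of_nat N :: ennreal)"
      using inverse_of_nat_mult_of_nat[OF k_pos[OF i]] by (metis mult.assoc mult.commute mult_1)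
    finally show "(\<integral>\<^sup>+ y. ennreal (f (i, y)) \<partial>P) = 1 / of_nat N" .
  next
    fix A assume A: "A \<in> sets P"
    have [measurable]: "A \<in> sets B" using A sets_P by simp
    have "(\<Sum>i\<in>{1..N}. \<integral>\<^sup>+ y. ennreal (f (i, y)) * indicator A y \<partial>P) =
        (\<Sum>i\<in>{1..N}. \<integral>\<^sup>+ z. J i z * indicator A (snd z) \<partial>\<pi>)"
      by (intro sum.cong refl int_f) measurable
    also have "\<dots> = (\<integral>\<^sup>+ z. indicator A (snd z) \<partial>\<pi>)"
      by (rule sum_int) measurable
    also have "\<dots> = emeasure P A"
      using A by (subst int_snd) auto
    finally show "(\<Sum>i\<in>{1..N}. \<integral>\<^sup>+ y. ennreal (f (i, y)) * indicator A y \<partial>P) = emeasure P A" .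
  qed
  moreover have "index_cost N P (cost x) f = (\<integral>\<^sup>+ z. ennreal (mdist m (fst z) (snd z) powr p) \<partial>\<pi>)"
  proof -
    have "index_cost N P (cost x) f =
        (\<Sum>i\<in>{1..N}. \<integral>\<^sup>+ y. ennreal (f (i, y)) * ennreal (mdist m (x i) y powr p) \<partial>P)"
      by (simp add: index_cost_def cost_def mult.commute)
    also have "\<dots> = (\<Sum>i\<in>{1..N}. \<integral>\<^sup>+ z. J i z * ennreal (mdist m (x i) (snd z) powr p) \<partial>\<pi>)"
    proof (intro sum.cong refl int_f)
      fix i assume "i \<in> {1..N}"
      note [measurable] = measurable_mdist[OF xi[OF this]]
      show "(\<lambda>y. ennreal (mdist m (x i) y powr p)) \<in> borel_measurable B" by measurable
    qed
    \<comment> \<open>The weight \<open>J i\<close> vanishes unless the first coordinate equals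
      \<open>x i\<close>, so the two costs agree wherever they count.\<close>
    also have "\<dots> = (\<Sum>i\<in>{1..N}. \<integral>\<^sup>+ z. J i z * ennreal (mdist m (fst z) (snd z) powr p) \<partial>\<pi>)"
      by (intro sum.cong refl nn_integral_cong) (auto simp: J_def indicator_def)
    also have "\<dots> = (\<integral>\<^sup>+ z. ennreal (mdist m (fst z) (snd z) powr p) \<partial>\<pi>)"
      by (rule sum_int) measurable
    finally show ?thesis .
  qed
  ultimately show ?thesis by blast
qed

end

section \<open>Optimal couplings and measurability\<close>

text \<open>The sum is at most twice the maximum. The crude constant suffices, as only finiteness of
  integrals is drawn from it.\<close>

lemma powr_add_le:
  fixes a b p :: real
  assumes "0 \<le> a" "0 \<le> b" "0 \<le> p"
  shows "(a + b) powr p \<le> 2 powr p * (a powr p + b powr p)"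
proof -
  have "(a + b) powr p \<le> (2 * max a b) powr p"
    using assms by (intro powr_mono2) auto
  also have "\<dots> = 2 powr p * (max a b powr p)"
    using assms by (simp add: powr_mult)
  also have "max a b powr p \<le> a powr p + b powr p"
    by (simp add: max_def)
  finally show ?thesis by simp
qed

context empirical_coupling
begin

lemma emeasure_mspace: "emeasure P (mspace m) = 1"
  using emeasure_space_1 by simp

text \<open>The two constructions preserve cost. The gain is a feasible set that does not vary with
  the sample, which enters the right-hand side through the cost function alone.\<close>

lemma Inf_couplings_eq_Inf_index_cost:
  assumes "x \<in> {1..N} \<rightarrow> mspace m"
  shows "(\<Sqinter>\<pi>\<in>couplings m (empirical B N x) P. \<integral>\<^sup>+ z. ennreal (mdist m (fst z) (snd z) powr p) \<partial>\<pi>)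
    = (\<Sqinter>f\<in>index_densities N P. index_cost N P (cost x) f)"
proof (rule antisym)
  show "(\<Sqinter>\<pi>\<in>couplings m (empirical B N x) P. \<integral>\<^sup>+ z. ennreal (mdist m (fst z) (snd z) powr p) \<partial>\<pi>)
    \<le> (\<Sqinter>f\<in>index_densities N P. index_cost N P (cost x) f)"
  proof (rule INF_greatest)
    fix f assume "f \<in> index_densities N P"
    then obtain \<pi> where "\<pi> \<in> couplings m (empirical B N x) P"
      "(\<integral>\<^sup>+ z. ennreal (mdist m (fst z) (snd z) powr p) \<partial>\<pi>) = index_cost N P (cost x) f"
      using coupling_of_index_density[OF assms] by blast
    then show "(\<Sqinter>\<pi>\<in>couplings m (empirical B N x) P. \<integral>\<^sup>+ z. ennreal (mdist m (fst z) (snd z) powr p) \<partial>\<pi>)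
      \<le> index_cost N P (cost x) f"
      by (intro INF_lower2[of \<pi>]) auto
  qed
  show "(\<Sqinter>f\<in>index_densities N P. index_cost N P (cost x) f) \<le>
    (\<Sqinter>\<pi>\<in>couplings m (empirical B N x) P. \<integral>\<^sup>+ z. ennreal (mdist m (fst z) (snd z) powr p) \<partial>\<pi>)"
  proof (rule INF_greatest)
    fix \<pi> assume "\<pi> \<in> couplings m (empirical B N x) P"
    then obtain f where "f \<in> index_densities N P"
      "index_cost N P (cost x) f = (\<integral>\<^sup>+ z. ennreal (mdist m (fst z) (snd z) powr p) \<partial>\<pi>)"
      using index_density_of_coupling[OF assms] by blast
    then show "(\<Sqinter>f\<in>index_densities N P. index_cost N P (cost x) f)
      \<le> (\<integral>\<^sup>+ z. ennreal (mdist m (fst z) (snd z) powr p) \<partial>\<pi>)"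
      by (intro INF_lower2[of f]) auto
  qed
qed

text \<open>This density corresponds to the product of the empirical measure with \<open>P\<close>.
  It is the competitor that makes the infimum finite.\<close>

lemma uniform_index_density: "(\<lambda>_. 1 / real N) \<in> index_densities N P"
proof -
  have N: "ennreal (1 / real N) = 1 / of_nat N"
    using N_pos by (simp add: divide_ennreal[symmetric] ennreal_of_nat_eq_real_of_nat)
  have N1: "of_nat N * (1 / of_nat N * a) = (a :: ennreal)" for a
    using inverse_of_nat_mult_of_nat[of N] N_pos by (metis One_nat_def Suc_le_eq mult.assoc mult.commute mult_1)
  show ?thesis
    using N_pos unfolding index_densities_def
    by (auto simp: nn_integral_cmult_indicator emeasure_mspace N N1)
qed

text \<open>The triangle inequality moves the base point from \<open>a\<close> to \<open>b\<close>
  at the price of a constant. The shift \<open>r\<close> is allowed for because the costs of nearby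
  samples are dominated by such shifted moments.\<close>

lemma moment_finite:
  assumes mom: "P \<in> probs_moment p m" and a: "a \<in> mspace m" and r: "0 \<le> r"
  shows "(\<integral>\<^sup>+ y. ennreal ((mdist m a y + r) powr p) \<partial>P) < \<infinity>"
proof -
  obtain b where b: "b \<in> mspace m" and fin: "(\<integral>\<^sup>+ y. ennreal (mdist m b y powr p) \<partial>P) < \<infinity>"
    using mom by (auto simp: probs_moment_def)
  note [measurable] = measurable_mdist[OF b]
  define s where "s = mdist m a b + r"
  have s: "0 \<le> s" using r by (simp add: s_def)
  have "(\<integral>\<^sup>+ y. ennreal ((mdist m a y + r) powr p) \<partial>P) \<le>
      (\<integral>\<^sup>+ y. ennreal (2 powr p) * (ennreal (mdist m b y powr p) + ennreal (s powr p)) \<partial>P)"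
  proof (rule nn_integral_mono)
    fix y assume "y \<in> space P"
    then have "mdist m a y + r \<le> mdist m b y + s"
      using mdist_triangle[of a m b y] a b by (simp add: s_def)
    then have "(mdist m a y + r) powr p \<le> (mdist m b y + s) powr p"
      using r p_ge_1 by (intro powr_mono2) auto
    also have "\<dots> \<le> 2 powr p * (mdist m b y powr p + s powr p)"
      using s p_ge_1 by (intro powr_add_le) auto
    finally show "ennreal ((mdist m a y + r) powr p) \<le>
        ennreal (2 powr p) * (ennreal (mdist m b y powr p) + ennreal (s powr p))"
      by (simp flip: ennreal_plus ennreal_mult add: ennreal_leI)
  qed
  also have "\<dots> = ennreal (2 powr p) * ((\<integral>\<^sup>+ y. ennreal (mdist m b y powr p) \<partial>P) + ennreal (s powr p))"
    by (simp add: nn_integral_cmult nn_integral_add emeasure_mspace)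
  also have "\<dots> < \<infinity>"
    using fin by (simp add: ennreal_mult_less_top)
  finally show ?thesis .
qed

lemma index_cost_finite:
  assumes mom: "P \<in> probs_moment p m" and x: "x \<in> {1..N} \<rightarrow> mspace m" and f: "f \<in> index_densities N P"
  shows "index_cost N P (cost x) f < \<infinity>"
proof -
  have "(\<integral>\<^sup>+ y. ennreal (cost x (i, y)) * ennreal (f (i, y)) \<partial>P) < \<infinity>" if "i \<in> {1..N}" for i
  proof -
    have "(\<integral>\<^sup>+ y. ennreal (cost x (i, y)) * ennreal (f (i, y)) \<partial>P) \<le>
        (\<integral>\<^sup>+ y. ennreal ((mdist m (x i) y + 0) powr p) \<partial>P)"
    proof (rule nn_integral_mono)
      fix y
      have "ennreal (cost x (i, y)) * ennreal (f (i, y)) \<le> ennreal (cost x (i, y)) * 1"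
        using index_densities_bounds(2)[OF f, of "(i, y)"] by (intro mult_left_mono) simp_all
      then show "ennreal (cost x (i, y)) * ennreal (f (i, y)) \<le> ennreal ((mdist m (x i) y + 0) powr p)"
        by (simp add: cost_def)
    qed
    also have "\<dots> < \<infinity>"
      using x that by (intro moment_finite mom) auto
    finally show ?thesis .
  qed
  then show ?thesis
    by (simp add: index_cost_def del: One_nat_def)
qed

text \<open>Finiteness of the infimum is the point: \<open>enn2real\<close> sends infinity to 0, so
  an infinite cost would pass for distance 0.\<close>

lemma wasserstein_empirical_le_iff:
  assumes mom: "P \<in> probs_moment p m" and x: "x \<in> {1..N} \<rightarrow> mspace m" and e: "0 < e"
  shows "wasserstein p m (empirical B N x) P \<le> e \<longleftrightarrow>
    (\<Sqinter>f\<in>index_densities N P. index_cost N P (cost x) f) \<le> ennreal (e powr p)"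
proof -
  let ?I = "\<Sqinter>f\<in>index_densities N P. index_cost N P (cost x) f"
  have "?I \<le> index_cost N P (cost x) (\<lambda>_. 1 / real N)"
    by (intro INF_lower uniform_index_density)
  also have "\<dots> < \<infinity>"
    by (rule index_cost_finite[OF mom x uniform_index_density])
  finally have fin: "?I < top" by simp
  have "wasserstein p m (empirical B N x) P \<le> e \<longleftrightarrow> enn2real ?I powr (1 / p) \<le> (e powr p) powr (1 / p)"
    unfolding wasserstein_def Inf_couplings_eq_Inf_index_cost[OF x]
    using e p_ge_1 by (simp add: powr_powr)
  also have "\<dots> \<longleftrightarrow> enn2real ?I \<le> e powr p"
    using p_ge_1 powr_mono2[of "1 / p" "enn2real ?I" "e powr p"]
      powr_less_mono2[of "1 / p" "e powr p" "enn2real ?I"] by fastforce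
  also have "\<dots> \<longleftrightarrow> ennreal (enn2real ?I) \<le> ennreal (e powr p)"
    by (simp add: ennreal_le_iff)
  finally show ?thesis
    using fin by simp
qed

text \<open>An infimum of at most \<open>e powr p\<close> supplies a density for every positive
  slack. The attainment lemma removes the slack, and the resulting density is turned back into a
  coupling.\<close>

lemma optimal_coupling_exists:
  assumes mom: "P \<in> probs_moment p m" and x: "x \<in> {1..N} \<rightarrow> mspace m" and e: "0 < e"
    and le: "wasserstein p m (empirical B N x) P \<le> e"
  shows "\<exists>\<pi>\<in>couplings m (empirical B N x) P.
    (\<integral>\<^sup>+ z. ennreal (mdist m (fst z) (snd z) powr p) \<partial>\<pi>) \<le> ennreal (e powr p)"
proof -
  have I: "(\<Sqinter>f\<in>index_densities N P. index_cost N P (cost x) f) \<le> ennreal (e powr p)"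
    using le wasserstein_empirical_le_iff[OF mom x e] by simp
  have "\<exists>f\<in>index_densities N P. index_cost N P (cost x) f \<le> ennreal (e powr p)"
  proof (rule index_density_attained[OF prob_space_axioms measurable_cost[OF x] cost_nonneg])
    fix j
    have "ennreal (e powr p) < ennreal (e powr p) + ennreal (1 / real (Suc j))"
      by (simp flip: ennreal_plus add: ennreal_less_iff del: of_nat_Suc)
    with I have "(\<Sqinter>f\<in>index_densities N P. index_cost N P (cost x) f) <
        ennreal (e powr p) + ennreal (1 / real (Suc j))"
      by (rule le_less_trans)
    then show "\<exists>f\<in>index_densities N P. index_cost N P (cost x) f \<le> ennreal (e powr p) + ennreal (1 / real (Suc j))"
      unfolding INF_less_iff by (auto intro: less_imp_le)
  qed
  then show ?thesis
    using coupling_of_index_density[OF x] by metis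
qed

lemma wasserstein_le_of_coupling:
  assumes mom: "P \<in> probs_moment p m" and x: "x \<in> {1..N} \<rightarrow> mspace m" and e: "0 < e"
    and \<pi>: "\<pi> \<in> couplings m (empirical B N x) P"
    and le: "(\<integral>\<^sup>+ z. ennreal (mdist m (fst z) (snd z) powr p) \<partial>\<pi>) \<le> ennreal (e powr p)"
  shows "wasserstein p m (empirical B N x) P \<le> e"
  unfolding wasserstein_empirical_le_iff[OF mom x e] Inf_couplings_eq_Inf_index_cost[OF x, symmetric]
  using INF_lower[OF \<pi>] le by (rule order.trans)

section \<open>Measurable dependence of the minimal cost on the sample\<close>

text \<open>The set of index densities does not depend on the sample, so the infimum is upper semicontinuous in it.\<close>

lemma openin_Inf_index_cost_less:
  assumes mom: "P \<in> probs_moment p m"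
  shows "openin (product_topology (\<lambda>_. mtopology_of m) {1..N})
    {x \<in> {1..N} \<rightarrow>\<^sub>E mspace m. (\<Sqinter>f\<in>index_densities N P. index_cost N P (cost x) f) < t}"
  unfolding openin_product_topology_alt
proof
  interpret Metric_space "mspace m" "mdist m" by simp
  fix x assume "x \<in> {x \<in> {1..N} \<rightarrow>\<^sub>E mspace m. (\<Sqinter>f\<in>index_densities N P. index_cost N P (cost x) f) < t}"
  then have xE: "x \<in> {1..N} \<rightarrow>\<^sub>E mspace m" and "\<exists>f\<in>index_densities N P. index_cost N P (cost x) f < t"
    by (auto simp: INF_less_iff)
  then obtain f where f: "f \<in> index_densities N P" and ft: "index_cost N P (cost x) f < t" by blast
  have xi: "x i \<in> mspace m" if "i \<in> {1..N}" for i
    using xE that by (auto simp: PiE_iff)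
  note f01 = index_densities_bounds[OF f]
  have fm: "f \<in> borel_measurable (count_space {1..N} \<Otimes>\<^sub>M P)"
    using f by (simp add: index_densities_def)
  \<comment> \<open>\<open>c r\<close> bounds the cost of the same \<open>f\<close> for every sample
    whose points lie within \<open>r\<close> of those of \<open>x\<close>. It tends to the cost at
    \<open>x\<close> as \<open>r\<close> shrinks, by dominated convergence with the case
    \<open>r = 1\<close> as majorant. A small \<open>r\<close> therefore gives a box of balls on
    which \<open>f\<close> still costs less than \<open>t\<close>.\<close>
  define c where "c r = (\<Sum>i\<in>{1..N}. \<integral>\<^sup>+ y. ennreal ((mdist m (x i) y + r) powr p) * ennreal (f (i, y)) \<partial>P)" for r
  have "(\<lambda>j. c (1 / real (Suc j))) \<longlonglongrightarrow> c 0"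
    unfolding c_def
  proof (rule tendsto_sum)
    fix i assume i: "i \<in> {1..N}"
    note [measurable] = measurable_mdist[OF xi[OF i]] measurable_count_space_slice[OF fm i]
    show "(\<lambda>j. \<integral>\<^sup>+ y. ennreal ((mdist m (x i) y + 1 / real (Suc j)) powr p) * ennreal (f (i, y)) \<partial>P) \<longlonglongrightarrow>
        (\<integral>\<^sup>+ y. ennreal ((mdist m (x i) y + 0) powr p) * ennreal (f (i, y)) \<partial>P)"
    proof (rule nn_integral_dominated_convergence[where w = "\<lambda>y. ennreal ((mdist m (x i) y + 1) powr p)"])
      show "AE y in P. ennreal ((mdist m (x i) y + 1 / real (Suc j)) powr p) * ennreal (f (i, y)) \<le>
          ennreal ((mdist m (x i) y + 1) powr p)" for j
      proof (rule AE_I2)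
        fix y
        have "ennreal ((mdist m (x i) y + 1 / real (Suc j)) powr p) * ennreal (f (i, y)) \<le>
            ennreal ((mdist m (x i) y + 1) powr p) * 1"
          using f01(2)[of "(i, y)"] p_ge_1 by (intro mult_mono ennreal_leI powr_mono2) auto
        then show "ennreal ((mdist m (x i) y + 1 / real (Suc j)) powr p) * ennreal (f (i, y)) \<le>
          ennreal ((mdist m (x i) y + 1) powr p)" by simp
      qed
      show "(\<integral>\<^sup>+ y. ennreal ((mdist m (x i) y + 1) powr p) \<partial>P) < \<infinity>"
        by (rule moment_finite[OF mom xi[OF i]]) simp
      show "AE y in P. (\<lambda>j. ennreal ((mdist m (x i) y + 1 / real (Suc j)) powr p) * ennreal (f (i, y))) \<longlonglongrightarrow>
          ennreal ((mdist m (x i) y + 0) powr p) * ennreal (f (i, y))"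
      proof (rule AE_I2)
        fix y
        have "(\<lambda>j. (mdist m (x i) y + 1 / real (Suc j)) powr p * f (i, y)) \<longlonglongrightarrow>
            (mdist m (x i) y + 0) powr p * f (i, y)"
          using p_ge_1
          by (intro tendsto_mult tendsto_powr2 tendsto_add tendsto_const LIMSEQ_Suc[OF lim_1_over_n] always_eventually allI)
            auto
        then show "(\<lambda>j. ennreal ((mdist m (x i) y + 1 / real (Suc j)) powr p) * ennreal (f (i, y))) \<longlonglongrightarrow>
          ennreal ((mdist m (x i) y + 0) powr p) * ennreal (f (i, y))"
          using f01(1) by (simp only: ennreal_mult'[OF f01(1), symmetric] ennreal_mult[symmetric] powr_ge_zero tendsto_ennrealI)
      qed
    qed measurable
  qed
  moreover have "c 0 < t"
    using ft by (simp add: c_def index_cost_def cost_def)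
  ultimately have "eventually (\<lambda>j. c (1 / real (Suc j)) < t) sequentially"
    by (rule order_tendstoD)
  then obtain j where j: "c (1 / real (Suc j)) < t"
    by (auto simp: eventually_sequentially)
  define r where "r = 1 / real (Suc j)"
  have r: "0 < r" "c r < t" using j by (auto simp: r_def)
  show "\<exists>U. finite {i \<in> {1..N}. U i \<noteq> topspace (mtopology_of m)} \<and>
      (\<forall>i\<in>{1..N}. openin (mtopology_of m) (U i)) \<and> x \<in> Pi\<^sub>E {1..N} U \<and>
      Pi\<^sub>E {1..N} U \<subseteq> {x \<in> {1..N} \<rightarrow>\<^sub>E mspace m. (\<Sqinter>f\<in>index_densities N P. index_cost N P (cost x) f) < t}"
  proof (intro exI[of _ "\<lambda>i. mball (x i) r"] conjI ballI subsetI)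
    show "openin (mtopology_of m) (mball (x i) r)" for i
      by (simp add: mtopology_of_def)
    show "x \<in> (\<Pi>\<^sub>E i\<in>{1..N}. mball (x i) r)"
      using xE xi r by (auto simp: PiE_iff)
    fix x' assume x': "x' \<in> (\<Pi>\<^sub>E i\<in>{1..N}. mball (x i) r)"
    then have x'E: "x' \<in> {1..N} \<rightarrow>\<^sub>E mspace m"
      by (auto simp: PiE_iff)
    have "index_cost N P (cost x') f \<le> c r"
      unfolding index_cost_def c_def
    proof (intro sum_mono nn_integral_mono mult_right_mono ennreal_leI)
      fix i y assume i: "i \<in> {1..N}" and y: "y \<in> space P"
      have "mdist m (x i) (x' i) < r" "x' i \<in> mspace m"
        using x' i by (auto simp: PiE_iff)
      then have "mdist m (x' i) y \<le> mdist m (x i) y + r"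
        using triangle[of "x' i" "x i" y] xi[OF i] y by (simp add: commute)
      then show "cost x' (i, y) \<le> (mdist m (x i) y + r) powr p"
        unfolding cost_def using p_ge_1 by (simp add: powr_mono2)
    qed simp
    also note \<open>c r < t\<close>
    finally show "x' \<in> {x \<in> {1..N} \<rightarrow>\<^sub>E mspace m. (\<Sqinter>f\<in>index_densities N P. index_cost N P (cost x) f) < t}"
      using x'E f by (auto simp: INF_less_iff)
  qed simp
qed

text \<open>Only strict sublevel sets of the minimal cost are known to be open. The non-strict one
  is their intersection over the thresholds \<open>?t j\<close>, which decrease to
  \<open>e powr p\<close>.\<close>

lemma measurable_wasserstein_empirical_le:
  assumes mom: "P \<in> probs_moment p m" and e: "0 < e"
  shows "{x \<in> {1..N} \<rightarrow>\<^sub>E mspace m. wasserstein p m (empirical B N x) P \<le> e} \<in> sets (PiM {1..N} (\<lambda>_. B))"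
proof -
  let ?I = "\<lambda>x. \<Sqinter>f\<in>index_densities N P. index_cost N P (cost x) f"
  let ?t = "\<lambda>j. ennreal (e powr p) + ennreal (1 / real (Suc j))"
  have "{x \<in> {1..N} \<rightarrow>\<^sub>E mspace m. ?I x < t} \<in> sets (PiM {1..N} (\<lambda>_. B))" for t
    using openin_imp_borel_alg[OF openin_Inf_index_cost_less[OF mom, of t]]
      sets_borel_alg_product_topology[of "{1..N}" "\<lambda>_. mtopology_of m"]
      separable_metric_imp_second_countable[OF separable] by simp
  then have "(\<Inter>j. {x \<in> {1..N} \<rightarrow>\<^sub>E mspace m. ?I x < ?t j}) \<in> sets (PiM {1..N} (\<lambda>_. B))"
    by (intro sets.countable_INT) auto
  also have "(\<Inter>j. {x \<in> {1..N} \<rightarrow>\<^sub>E mspace m. ?I x < ?t j}) =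
      {x \<in> {1..N} \<rightarrow>\<^sub>E mspace m. wasserstein p m (empirical B N x) P \<le> e}"
  proof -
    have "(\<forall>j. ?I x < ?t j) \<longleftrightarrow> wasserstein p m (empirical B N x) P \<le> e"
      if x: "x \<in> {1..N} \<rightarrow>\<^sub>E mspace m" for x
    proof -
      have x': "x \<in> {1..N} \<rightarrow> mspace m"
        using x by (rule PiE_mem[THEN Pi_I])
      have "(\<lambda>j. ?t j) \<longlonglongrightarrow> ennreal (e powr p) + ennreal 0"
        by (intro tendsto_add tendsto_const tendsto_ennrealI LIMSEQ_Suc[OF lim_1_over_n])
      then have lim: "?t \<longlonglongrightarrow> ennreal (e powr p)" by simp
      have less: "ennreal (e powr p) < ?t j" for j
        by (simp flip: ennreal_plus add: ennreal_less_iff del: of_nat_Suc)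
      have "(\<forall>j. ?I x < ?t j) \<longleftrightarrow> ?I x \<le> ennreal (e powr p)"
      proof
        assume "\<forall>j. ?I x < ?t j"
        then show "?I x \<le> ennreal (e powr p)"
          by (intro LIMSEQ_le_const[OF lim] exI[of _ 0]) (simp add: less_imp_le)
      qed (intro allI le_less_trans[OF _ less])
      then show ?thesis
        using wasserstein_empirical_le_iff[OF mom x' e] by simp
    qed
    then show ?thesis by auto
  qed
  finally show ?thesis .
qed

end

section \<open>Plans on the product space\<close>

lemma couplings_iff:
  assumes "separable_space (mtopology_of m)"
  shows "\<pi> \<in> couplings m Q P \<longleftrightarrow> prob_space \<pi> \<and> sets \<pi> = sets (mborel m \<Otimes>\<^sub>M mborel m) \<and>
    distr \<pi> (mborel m) fst = Q \<and> distr \<pi> (mborel m) snd = P"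
  by (simp add: couplings_def transport_plans_def borel_probs_def sets_borel_alg_mtopology_square[OF assms])

locale polish_factors =
  fixes n :: nat and m :: "nat \<Rightarrow> 'a metric" and \<rho> :: "(nat \<Rightarrow> 'a) metric"
  assumes polish: "polish_product n m \<rho>"
begin

lemma separable_factor: "k \<in> {1..n} \<Longrightarrow> separable_space (mtopology_of (m k))"
  and separable_product: "separable_space (mtopology_of \<rho>)"
  using polish by (auto simp: polish_product_def polish_metric_def)

lemma sets_product: "sets (mborel \<rho>) = sets (PiM {1..n} (\<lambda>k. mborel (m k)))"
proof -
  have "mborel \<rho> = borel_alg (product_topology (\<lambda>k. mtopology_of (m k)) {1..n})"
    using polish by (simp add: polish_product_def)
  then show ?thesis
    using separable_factor
    by (simp only: sets_borel_alg_product_topology separable_metric_imp_second_countable finite_atLeastAtMost)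
qed

lemma mspace_product: "mspace \<rho> = (\<Pi>\<^sub>E k\<in>{1..n}. mspace (m k))"
  using sets_eq_imp_space_eq[OF sets_product] by (simp add: space_PiM)

lemma measurable_component: "k \<in> {1..n} \<Longrightarrow> (\<lambda>x. x k) \<in> measurable (mborel \<rho>) (mborel (m k))"
  unfolding measurable_cong_sets[OF sets_product refl] by (rule measurable_component_singleton)

lemma measurable_cost_component:
  assumes k: "k \<in> {1..n}"
  shows "(\<lambda>z. mdist (m k) (fst z k) (snd z k) powr p) \<in> borel_measurable (mborel \<rho> \<Otimes>\<^sub>M mborel \<rho>)"
proof -
  note [measurable] = measurable_component[OF k] borel_measurable_mdist_pair[OF separable_factor[OF k]]
  have "(\<lambda>z. (fst z k, snd z k)) \<in> measurable (mborel \<rho> \<Otimes>\<^sub>M mborel \<rho>) (mborel (m k) \<Otimes>\<^sub>M mborel (m k))"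
    by measurable
  from measurable_compose[OF this borel_measurable_mdist_pair[OF separable_factor[OF k]]]
  have [measurable]: "(\<lambda>z. mdist (m k) (fst z k) (snd z k)) \<in> borel_measurable (mborel \<rho> \<Otimes>\<^sub>M mborel \<rho>)"
    by simp
  show ?thesis by measurable
qed

text \<open>The product of the \<open>\<pi> k\<close> lives on functions with values in pairs;
  regrouping these as pairs of functions gives the plan. Its cost in component \<open>k\<close> is
  that of \<open>\<pi> k\<close>.\<close>

lemma product_coupling_in_hyperrectangle:
  assumes \<pi>: "\<And>k. k \<in> {1..n} \<Longrightarrow> \<pi> k \<in> couplings (m k) (Q k) (P k)"
    and cost: "\<And>k. k \<in> {1..n} \<Longrightarrow>
      (\<integral>\<^sup>+ z. ennreal (mdist (m k) (fst z) (snd z) powr p) \<partial>\<pi> k) \<le> ennreal (\<epsilon> k powr p)"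
  shows "PiM {1..n} P \<in> multi_transport_hyperrectangle p n m \<rho> (PiM {1..n} Q) \<epsilon>"
proof -
  have \<pi>D: "prob_space (\<pi> k)" "sets (\<pi> k) = sets (mborel (m k) \<Otimes>\<^sub>M mborel (m k))"
    "distr (\<pi> k) (mborel (m k)) fst = Q k" "distr (\<pi> k) (mborel (m k)) snd = P k" if "k \<in> {1..n}" for k
    using \<pi>[OF that] couplings_iff[OF separable_factor[OF that]] by auto
  have fstm: "fst \<in> measurable (\<pi> k) (mborel (m k))" and sndm: "snd \<in> measurable (\<pi> k) (mborel (m k))"
    if "k \<in> {1..n}" for k
    unfolding measurable_cong_sets[OF \<pi>D(2)[OF that] refl] by simp_all
  \<comment> \<open>Serves both marginals, with \<open>fst\<close> and \<open>snd\<close> for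
    \<open>g\<close>. The targets are switched from \<open>mborel (m k)\<close> to
    \<open>R k\<close>, which has the same \<sigma>-algebra and is a probability measure.\<close>
  have marg: "distr (PiM {1..n} \<pi>) (mborel \<rho>) (compose {1..n} g) = PiM {1..n} R"
    if gm: "\<And>k. k \<in> {1..n} \<Longrightarrow> g \<in> measurable (\<pi> k) (mborel (m k))"
      and R: "\<And>k. k \<in> {1..n} \<Longrightarrow> distr (\<pi> k) (mborel (m k)) g = R k" for g R
  proof -
    have sR: "sets (R k) = sets (mborel (m k))" if "k \<in> {1..n}" for k
      using R[OF that] by (metis sets_distr)
    have gR: "g \<in> measurable (\<pi> k) (R k)" if "k \<in> {1..n}" for k
      using gm[OF that] by (simp add: measurable_cong_sets[OF refl sR[OF that]])
    have "sets (mborel \<rho>) = sets (PiM {1..n} R)"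
      unfolding sets_product using sR by (intro sets_PiM_cong) auto
    then have "distr (PiM {1..n} \<pi>) (mborel \<rho>) (compose {1..n} g) =
        distr (PiM {1..n} \<pi>) (PiM {1..n} R) (compose {1..n} g)"
      by (intro distr_cong) auto
    also have "\<dots> = PiM {1..n} (\<lambda>k. distr (\<pi> k) (R k) g)"
      using \<pi>D(1) gm R gR
      by (intro distr_PiM_finite_prob_space') (auto intro: prob_space.prob_space_distr simp flip: R)
    also have "\<dots> = PiM {1..n} R"
    proof (rule PiM_cong[OF refl])
      fix k assume k: "k \<in> {1..n}"
      have "distr (\<pi> k) (R k) g = distr (\<pi> k) (mborel (m k)) g"
        using sR[OF k] by (intro distr_cong) auto
      then show "distr (\<pi> k) (R k) g = R k" using R[OF k] by simp
    qed
    finally show ?thesis .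
  qed
  define T where "T z = (compose {1..n} fst z, compose {1..n} snd z)" for z :: "nat \<Rightarrow> 'a \<times> 'a"
  have comp: "compose {1..n} g \<in> measurable (PiM {1..n} \<pi>) (mborel \<rho>)"
    if "\<And>k. k \<in> {1..n} \<Longrightarrow> g \<in> measurable (\<pi> k) (mborel (m k))" for g
    unfolding measurable_cong_sets[OF refl sets_product] compose_def
    using that by (intro measurable_restrict measurable_compose[OF measurable_component_singleton]) auto
  have T [measurable]: "T \<in> measurable (PiM {1..n} \<pi>) (mborel \<rho> \<Otimes>\<^sub>M mborel \<rho>)"
    unfolding T_def using fstm sndm by (intro measurable_Pair comp) auto
  define \<Theta> where "\<Theta> = distr (PiM {1..n} \<pi>) (mborel \<rho> \<Otimes>\<^sub>M mborel \<rho>) T"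
  have "prob_space (PiM {1..n} \<pi>)"
    using \<pi>D(1) by (rule prob_space_PiM)
  then have "prob_space \<Theta>"
    unfolding \<Theta>_def by (rule prob_space.prob_space_distr) (rule T)
  then have "\<Theta> \<in> transport_plans \<rho>"
    by (simp add: transport_plans_def borel_probs_def sets_borel_alg_mtopology_square[OF separable_product] \<Theta>_def)
  moreover have "distr \<Theta> (mborel \<rho>) fst = PiM {1..n} Q"
  proof -
    have "distr \<Theta> (mborel \<rho>) fst = distr (PiM {1..n} \<pi>) (mborel \<rho>) (compose {1..n} fst)"
      unfolding \<Theta>_def by (subst distr_distr[OF measurable_fst T]) (simp add: T_def comp_def)
    also have "\<dots> = PiM {1..n} Q"
      using fstm \<pi>D(3) by (rule marg)
    finally show ?thesis .
  qed
  moreover have "distr \<Theta> (mborel \<rho>) snd = PiM {1..n} P"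
  proof -
    have "distr \<Theta> (mborel \<rho>) snd = distr (PiM {1..n} \<pi>) (mborel \<rho>) (compose {1..n} snd)"
      unfolding \<Theta>_def by (subst distr_distr[OF measurable_snd T]) (simp add: T_def comp_def)
    also have "\<dots> = PiM {1..n} P"
      using sndm \<pi>D(4) by (rule marg)
    finally show ?thesis .
  qed
  moreover have "(\<integral>\<^sup>+ z. ennreal (mdist (m k) (fst z k) (snd z k) powr p) \<partial>\<Theta>) \<le> ennreal (\<epsilon> k powr p)"
    if k: "k \<in> {1..n}" for k
  proof -
    have [measurable]: "(\<lambda>z. mdist (m k) (fst z) (snd z)) \<in> borel_measurable (\<pi> k)"
      unfolding measurable_cong_sets[OF \<pi>D(2)[OF k] refl]
      by (rule borel_measurable_mdist_pair[OF separable_factor[OF k]])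
    have "(\<integral>\<^sup>+ z. ennreal (mdist (m k) (fst z k) (snd z k) powr p) \<partial>\<Theta>) =
        (\<integral>\<^sup>+ z. ennreal (mdist (m k) (fst (z k)) (snd (z k)) powr p) \<partial>PiM {1..n} \<pi>)"
      unfolding \<Theta>_def using k
      by (subst nn_integral_distr[OF T]) (simp_all add: T_def compose_def measurable_cost_component)
    \<comment> \<open>The integrand depends on coordinate \<open>k\<close> alone, whose law under
      the product measure is \<open>\<pi> k\<close>.\<close>
    also have "\<dots> = (\<integral>\<^sup>+ z. ennreal (mdist (m k) (fst z) (snd z) powr p) \<partial>distr (PiM {1..n} \<pi>) (\<pi> k) (\<lambda>z. z k))"
      using k by (subst nn_integral_distr) (auto intro: measurable_component_singleton)
    also have "\<dots> = (\<integral>\<^sup>+ z. ennreal (mdist (m k) (fst z) (snd z) powr p) \<partial>\<pi> k)"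
      by (subst distr_PiM_component[OF \<pi>D(1) k]) auto
    finally show ?thesis using cost[OF k] by simp
  qed
  ultimately show ?thesis
    unfolding multi_transport_hyperrectangle_def by (intro CollectI exI[of _ \<Theta>]) simp
qed

text \<open>The coupling is the image of the plan under the projection of both arguments to
  component \<open>k\<close>. This direction makes the event of the theorem equal to the
  intersection of the ball events, and thereby measurable.\<close>

lemma hyperrectangle_component_coupling:
  assumes QP: "\<And>k. k \<in> {1..n} \<Longrightarrow> prob_space (Q k)" "\<And>k. k \<in> {1..n} \<Longrightarrow> prob_space (P k)"
    and sets: "\<And>k. k \<in> {1..n} \<Longrightarrow> sets (Q k) = sets (mborel (m k))"
      "\<And>k. k \<in> {1..n} \<Longrightarrow> sets (P k) = sets (mborel (m k))"
    and mem: "PiM {1..n} P \<in> multi_transport_hyperrectangle p n m \<rho> (PiM {1..n} Q) \<epsilon>"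
    and k: "k \<in> {1..n}"
  shows "\<exists>\<pi>\<in>couplings (m k) (Q k) (P k).
    (\<integral>\<^sup>+ z. ennreal (mdist (m k) (fst z) (snd z) powr p) \<partial>\<pi>) \<le> ennreal (\<epsilon> k powr p)"
proof -
  obtain \<pi> where \<pi>: "\<pi> \<in> transport_plans \<rho>" "distr \<pi> (mborel \<rho>) fst = PiM {1..n} Q"
      "distr \<pi> (mborel \<rho>) snd = PiM {1..n} P"
    and cost: "(\<integral>\<^sup>+ z. ennreal (mdist (m k) (fst z k) (snd z k) powr p) \<partial>\<pi>) \<le> ennreal (\<epsilon> k powr p)"
    using mem k unfolding multi_transport_hyperrectangle_def by (elim CollectE exE conjE) simp
  interpret \<pi>: prob_space \<pi>
    using \<pi>(1) by (simp add: transport_plans_def borel_probs_def)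
  have sets_\<pi> [measurable_cong]: "sets \<pi> = sets (mborel \<rho> \<Otimes>\<^sub>M mborel \<rho>)"
    using \<pi>(1) by (simp add: transport_plans_def borel_probs_def sets_borel_alg_mtopology_square[OF separable_product])
  note comp [measurable] = measurable_component[OF k]
  define T where "T z = (fst z k, snd z k)" for z :: "(nat \<Rightarrow> 'a) \<times> (nat \<Rightarrow> 'a)"
  have T [measurable]: "T \<in> measurable \<pi> (mborel (m k) \<Otimes>\<^sub>M mborel (m k))"
    unfolding T_def by measurable
  have fstm: "fst \<in> measurable \<pi> (mborel \<rho>)" and sndm: "snd \<in> measurable \<pi> (mborel \<rho>)"
    by measurable
  define \<pi>' where "\<pi>' = distr \<pi> (mborel (m k) \<Otimes>\<^sub>M mborel (m k)) T"
  have marg: "distr (PiM {1..n} R) (mborel (m k)) (\<lambda>z. z k) = R k"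
    if "\<And>k. k \<in> {1..n} \<Longrightarrow> prob_space (R k)" "sets (R k) = sets (mborel (m k))" for R :: "nat \<Rightarrow> 'a measure"
  proof -
    have "distr (PiM {1..n} R) (mborel (m k)) (\<lambda>z. z k) = distr (PiM {1..n} R) (R k) (\<lambda>z. z k)"
      using that(2) by (intro distr_cong) auto
    also have "\<dots> = R k"
      using that(1) k by (rule distr_PiM_component)
    finally show ?thesis .
  qed
  have "distr \<pi>' (mborel (m k)) fst = distr (distr \<pi> (mborel \<rho>) fst) (mborel (m k)) (\<lambda>z. z k)"
    unfolding \<pi>'_def by (simp add: distr_distr[OF measurable_fst T] distr_distr[OF comp fstm] T_def comp_def)
  then have 1: "distr \<pi>' (mborel (m k)) fst = Q k"
    using \<pi>(2) marg[of Q, OF QP(1) sets(1)[OF k]] by simp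
  have "distr \<pi>' (mborel (m k)) snd = distr (distr \<pi> (mborel \<rho>) snd) (mborel (m k)) (\<lambda>z. z k)"
    unfolding \<pi>'_def by (simp add: distr_distr[OF measurable_snd T] distr_distr[OF comp sndm] T_def comp_def)
  then have 2: "distr \<pi>' (mborel (m k)) snd = P k"
    using \<pi>(3) marg[of P, OF QP(2) sets(2)[OF k]] by simp
  have "\<pi>' \<in> couplings (m k) (Q k) (P k)"
    unfolding couplings_iff[OF separable_factor[OF k]] using 1 2
    by (simp add: \<pi>'_def \<pi>.prob_space_distr)
  moreover have "(\<integral>\<^sup>+ z. ennreal (mdist (m k) (fst z) (snd z) powr p) \<partial>\<pi>') \<le> ennreal (\<epsilon> k powr p)"
  proof -
    note [measurable] = borel_measurable_mdist_pair[OF separable_factor[OF k]]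
    show ?thesis
      unfolding \<pi>'_def using cost by (subst nn_integral_distr) (simp_all add: T_def)
  qed
  ultimately show ?thesis by blast
qed

end

section \<open>Independence of the columns of a sample\<close>

context prob_space
begin

text \<open>The rows are independent, and each has the law of \<open>Y\<close>, whose components are
  independent. An event made of conditions on single entries thus factorizes first over the rows and
  then within each row.\<close>

lemma indep_vars_array:
  assumes I: "finite I" "I \<noteq> {}" and J: "finite J" "J \<noteq> {}"
    and X: "indep_vars (\<lambda>_. N) X I"
    and comp: "\<And>k. k \<in> J \<Longrightarrow> (\<lambda>x. x k) \<in> measurable N (N' k)"
    and Y [measurable]: "Y \<in> measurable M N"
    and Y_indep: "indep_vars N' (\<lambda>k \<omega>. Y \<omega> k) J"
    and distr: "\<And>i. i \<in> I \<Longrightarrow> distr M N (X i) = distr M N Y"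
  shows "indep_vars (\<lambda>(i, k). N' k) (\<lambda>(i, k) \<omega>. X i \<omega> k) (I \<times> J)"
proof -
  have Xm: "X i \<in> measurable M N" if "i \<in> I" for i
    using X that by (simp add: indep_vars_def)
  have eq: "prob (X i -` C \<inter> space M) = prob (Y -` C \<inter> space M)" if "i \<in> I" "C \<in> sets N" for i C
    using measure_distr[OF Xm[OF that(1)] that(2)] measure_distr[OF Y that(2)] distr[OF that(1)] by simp
  have IJ: "I \<times> J \<noteq> {}" "finite (I \<times> J)" using I J by auto
  show ?thesis
  proof (subst indep_vars_finite[OF IJ, where E = "\<lambda>z. sets (case z of (i, k) \<Rightarrow> N' k)"], goal_cases)
    case (1 z)
    show ?case by (rule sets.sigma_sets_eq[symmetric])
  next
    case (2 z)
    then show ?case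
      by (cases z) (auto intro!: measurable_compose[OF Xm comp])
  next
    case (3 z)
    show ?case by (rule sets.Int_stable)
  next
    case (4 z)
    show ?case by (rule sets.top)
  next
    case (5 z)
    show ?case by (rule sets.space_closed)
  next
    case 6
    show ?case
    proof
      fix A assume "A \<in> (\<Pi> z\<in>I \<times> J. sets (case z of (i, k) \<Rightarrow> N' k))"
      then have A: "A (i, k) \<in> sets (N' k)" if "i \<in> I" "k \<in> J" for i k
        using that by (auto simp: Pi_iff)
      \<comment> \<open>All conditions on row \<open>i\<close>, collected in one set, so that
        independence of the rows applies.\<close>
      define C where "C i = (\<Inter>k\<in>J. (\<lambda>x. x k) -` A (i, k) \<inter> space N)" for i
      have C: "C i \<in> sets N" if "i \<in> I" for i
        unfolding C_def using J A[OF that]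
        by (intro sets.finite_INT) (auto intro: measurable_sets[OF comp])
      have row: "prob (X i -` C i \<inter> space M) = (\<Prod>k\<in>J. prob ((\<lambda>\<omega>. X i \<omega> k) -` A (i, k) \<inter> space M))"
        if i: "i \<in> I" for i
      proof -
        \<comment> \<open>Equality of the laws of the rows carries over to the entries, so the
          factorization known for \<open>Y\<close> holds for row \<open>i\<close> as well.\<close>
        have entry: "prob ((\<lambda>\<omega>. X i \<omega> k) -` A (i, k) \<inter> space M) = prob ((\<lambda>\<omega>. Y \<omega> k) -` A (i, k) \<inter> space M)"
          if k: "k \<in> J" for k
        proof -
          define D where "D = (\<lambda>x. x k) -` A (i, k) \<inter> space N"
          have "D \<in> sets N"
            unfolding D_def by (rule measurable_sets[OF comp[OF k] A[OF i k]])
          moreover have "X i -` D \<inter> space M = (\<lambda>\<omega>. X i \<omega> k) -` A (i, k) \<inter> space M"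
            using measurable_space[OF Xm[OF i]] by (auto simp: D_def)
          moreover have "Y -` D \<inter> space M = (\<lambda>\<omega>. Y \<omega> k) -` A (i, k) \<inter> space M"
            using measurable_space[OF Y] by (auto simp: D_def)
          ultimately show ?thesis using eq[OF i, of D] by simp
        qed
        have "prob (X i -` C i \<inter> space M) = prob (Y -` C i \<inter> space M)"
          by (rule eq[OF i C[OF i]])
        also have "Y -` C i \<inter> space M = (\<Inter>k\<in>J. (\<lambda>\<omega>. Y \<omega> k) -` A (i, k) \<inter> space M)"
          using J measurable_space[OF Y] by (auto simp: C_def)
        also have "prob \<dots> = (\<Prod>k\<in>J. prob ((\<lambda>\<omega>. Y \<omega> k) -` A (i, k) \<inter> space M))"
          using A[OF i] by (rule indep_varsD_finite[OF Y_indep J(2,1)])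
        finally show ?thesis using entry by simp
      qed
      have "(\<Inter>z\<in>I \<times> J. (case z of (i, k) \<Rightarrow> \<lambda>\<omega>. X i \<omega> k) -` A z \<inter> space M) = (\<Inter>i\<in>I. X i -` C i \<inter> space M)"
      proof -
        have "X i -` C i \<inter> space M = (\<Inter>k\<in>J. (\<lambda>\<omega>. X i \<omega> k) -` A (i, k) \<inter> space M)" if "i \<in> I" for i
          using J measurable_space[OF Xm[OF that]] by (auto simp: C_def)
        then show ?thesis by auto
      qed
      also have "prob \<dots> = (\<Prod>i\<in>I. prob (X i -` C i \<inter> space M))"
        using C by (rule indep_varsD_finite[OF X I(2,1)])
      also have "\<dots> = (\<Prod>i\<in>I. \<Prod>k\<in>J. prob ((\<lambda>\<omega>. X i \<omega> k) -` A (i, k) \<inter> space M))"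
        using row by (rule prod.cong[OF refl])
      also have "\<dots> = (\<Prod>z\<in>I \<times> J. prob ((case z of (i, k) \<Rightarrow> \<lambda>\<omega>. X i \<omega> k) -` A z \<inter> space M))"
        by (simp add: prod.cartesian_product case_prod_unfold)
      finally show "prob (\<Inter>z\<in>I \<times> J. (case z of (i, k) \<Rightarrow> \<lambda>\<omega>. X i \<omega> k) -` A z \<inter> space M) =
        (\<Prod>z\<in>I \<times> J. prob ((case z of (i, k) \<Rightarrow> \<lambda>\<omega>. X i \<omega> k) -` A z \<inter> space M))" .
    qed
  qed
qed

text \<open>The columns occupy the disjoint index blocks \<open>I \<times> {k}\<close>, and blocks
  of an independent family are independent.\<close>

lemma prob_INT_columns:
  assumes J: "finite J" "J \<noteq> {}"
    and indep: "indep_vars (\<lambda>(i, k). N' k) (\<lambda>(i, k) \<omega>. X i \<omega> k) (I \<times> J)"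
    and G: "\<And>k. k \<in> J \<Longrightarrow> G k \<in> sets (PiM I (\<lambda>_. N' k))"
  shows "prob (\<Inter>k\<in>J. {\<omega> \<in> space M. (\<lambda>i\<in>I. X i \<omega> k) \<in> G k}) =
    (\<Prod>k\<in>J. prob {\<omega> \<in> space M. (\<lambda>i\<in>I. X i \<omega> k) \<in> G k})"
proof -
  let ?N = "\<lambda>z. case z of (i, k) \<Rightarrow> N' k" and ?X = "\<lambda>z. case z of (i, k) \<Rightarrow> \<lambda>\<omega>. X i \<omega> k"
  let ?Z = "\<lambda>k \<omega>. restrict (\<lambda>z. ?X z \<omega>) (I \<times> {k})"
  \<comment> \<open>\<open>G k\<close> pulled back along the relabelling of \<open>i\<close> as
    \<open>(i, k)\<close>, because the block is indexed by pairs.\<close>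
  define H where "H k = (\<lambda>y. \<lambda>i\<in>I. y (i, k)) -` G k \<inter> space (PiM (I \<times> {k}) ?N)" for k
  have col: "indep_vars (\<lambda>k. PiM (I \<times> {k}) ?N) ?Z J"
    using indep_vars_restrict[OF indep, of J "\<lambda>k. I \<times> {k}"] by (auto simp: disjoint_family_on_def)
  have H: "H k \<in> sets (PiM (I \<times> {k}) ?N)" if k: "k \<in> J" for k
  proof -
    have "(\<lambda>y. \<lambda>i\<in>I. y (i, k)) \<in> measurable (PiM (I \<times> {k}) ?N) (PiM I (\<lambda>_. N' k))"
    proof (rule measurable_restrict)
      fix i assume "i \<in> I"
      then show "(\<lambda>y. y (i, k)) \<in> measurable (PiM (I \<times> {k}) ?N) (N' k)"
        using measurable_component_singleton[of "(i, k)" "I \<times> {k}" ?N] by simp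
    qed
    then show ?thesis
      unfolding H_def by (rule measurable_sets[OF _ G[OF k]])
  qed
  have eq: "?Z k -` H k \<inter> space M = {\<omega> \<in> space M. (\<lambda>i\<in>I. X i \<omega> k) \<in> G k}" if k: "k \<in> J" for k
  proof -
    have "?Z k \<in> measurable M (PiM (I \<times> {k}) ?N)"
      using col k by (simp add: indep_vars_def)
    from measurable_space[OF this] have sp: "?Z k \<omega> \<in> space (PiM (I \<times> {k}) ?N)" if "\<omega> \<in> space M" for \<omega>
      using that by blast
    have "(\<lambda>i\<in>I. ?Z k \<omega> (i, k)) = (\<lambda>i\<in>I. X i \<omega> k)" for \<omega>
      by (rule restrict_ext) simp
    then show ?thesis
      using sp by (auto simp: H_def)
  qed
  have "prob (\<Inter>k\<in>J. ?Z k -` H k \<inter> space M) = (\<Prod>k\<in>J. prob (?Z k -` H k \<inter> space M))"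
    using H by (rule indep_varsD_finite[OF col J(2,1)])
  then show ?thesis
    using eq by simp
qed

end

section \<open>Empirical measures of samples and the confidence bound\<close>

lemma empirical_cong:
  "(\<And>i. i \<in> {1..N} \<Longrightarrow> x i = y i) \<Longrightarrow> empirical B N x = empirical B N y"
  unfolding empirical_def by (intro arg_cong[of _ _ "measure_of _ _"] ext arg_cong2[of _ _ _ _ times] sum.cong) auto

lemma prob_space_empirical:
  assumes "1 \<le> N" "x \<in> {1..N} \<rightarrow> space B"
  shows "prob_space (empirical B N x)"
proof
  have "emeasure (empirical B N x) (space B) = 1 / of_nat N * (\<Sum>i\<in>{1..N}. 1)"
    using assms(2) by (subst emeasure_empirical) (auto simp: Pi_iff indicator_def intro!: arg_cong2[of _ _ _ _ times] sum.cong)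
  also have "\<dots> = 1"
    using inverse_of_nat_mult_of_nat[of N] assms(1) by simp
  finally show "emeasure (empirical B N x) (space (empirical B N x)) = 1" by simp
qed

theorem corollary4p5:
  fixes p :: real and n N :: nat
    and m :: "nat \<Rightarrow> 'a metric" and \<rho> :: "(nat \<Rightarrow> 'a) metric"
    and M :: "'w measure"
    and \<xi> :: "'w \<Rightarrow> nat \<Rightarrow> 'a" and X :: "nat \<Rightarrow> 'w \<Rightarrow> nat \<Rightarrow> 'a"
    and \<epsilon> \<beta> :: "nat \<Rightarrow> real"
  assumes "1 \<le> p" and "1 \<le> n" and "1 \<le> N"
    and "polish_product n m \<rho>"
    and "prob_space M"
    and "\<xi> \<in> measurable M (mborel \<rho>)"
    and "prob_space.indep_vars M (\<lambda>k. mborel (m k)) (\<lambda>k \<omega>. \<xi> \<omega> k) {1..n}"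
    and "distr M (mborel \<rho>) \<xi> \<in> probs_moment p \<rho>"
    and "prob_space.indep_vars M (\<lambda>_. mborel \<rho>) X {1..N}"
    and "\<And>i. i \<in> {1..N} \<Longrightarrow> distr M (mborel \<rho>) (X i) = distr M (mborel \<rho>) \<xi>"
    and "\<And>k. k \<in> {1..n} \<Longrightarrow> 0 < \<epsilon> k"
    and "\<And>k. k \<in> {1..n} \<Longrightarrow> \<beta> k \<in> {0..1}"
    and "\<And>k. k \<in> {1..n} \<Longrightarrow>
      \<P>(\<omega> in M. distr M (mborel (m k)) (\<lambda>\<omega>. \<xi> \<omega> k)
        \<in> wasserstein_ball p (m k) (empirical (mborel (m k)) N (\<lambda>i. X i \<omega> k)) (\<epsilon> k))
      \<ge> 1 - \<beta> k"
  shows "\<P>(\<omega> in M. distr M (mborel \<rho>) \<xi>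
        \<in> multi_transport_hyperrectangle p n m \<rho> (product_empirical n m N (\<lambda>i. X i \<omega>)) \<epsilon>)
      \<ge> (\<Prod>k\<in>{1..n}. 1 - \<beta> k)"
proof (cases "\<exists>k\<in>{1..n}. \<beta> k = 1")
  \<comment> \<open>A factor 0 makes the bound trivial. In the other case every
    \<open>\<beta> k\<close> is below 1, so each ball event has positive probability.\<close>
  case True
  then have "(\<Prod>k\<in>{1..n}. 1 - \<beta> k) = 0"
    by (intro prod_zero) auto
  then show ?thesis
    by (simp only: measure_nonneg)
next
  case False
  then have \<beta>: "\<beta> k < 1" if "k \<in> {1..n}" for k
    using assms(12)[OF that] that False by (metis atLeastAtMost_iff order_le_less)
  interpret M: prob_space M by fact
  interpret polish_factors n m \<rho> by standard fact
  define P where "P k = distr M (mborel (m k)) (\<lambda>\<omega>. \<xi> \<omega> k)" for k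
  define Q where "Q \<omega> k = empirical (mborel (m k)) N (\<lambda>i. X i \<omega> k)" for \<omega> k
  define E where "E k = {\<omega> \<in> space M. P k \<in> wasserstein_ball p (m k) (Q \<omega> k) (\<epsilon> k)}" for k
  have E_prob: "1 - \<beta> k \<le> measure M (E k)" if "k \<in> {1..n}" for k
    using assms(13)[OF that] by (simp add: E_def P_def Q_def)
  have \<xi>m: "\<xi> \<in> measurable M (mborel \<rho>)" by fact
  have \<xi>k: "(\<lambda>\<omega>. \<xi> \<omega> k) \<in> measurable M (mborel (m k))" if "k \<in> {1..n}" for k
    by (rule measurable_compose[OF \<xi>m measurable_component[OF that]])
  have P_prob: "prob_space (P k)" if "k \<in> {1..n}" for k
    unfolding P_def by (rule M.prob_space_distr[OF \<xi>k[OF that]])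
  \<comment> \<open>Independence of the components makes the joint law the product of the marginals,
    the form in which the hyperrectangle lemmas apply.\<close>
  have law: "distr M (mborel \<rho>) \<xi> = PiM {1..n} P"
  proof -
    have "distr M (mborel \<rho>) \<xi> = distr M (PiM {1..n} (\<lambda>k. mborel (m k))) (\<lambda>\<omega>. \<lambda>k\<in>{1..n}. \<xi> \<omega> k)"
    proof (rule distr_cong[OF refl sets_product])
      fix \<omega> assume "\<omega> \<in> space M"
      then have "\<xi> \<omega> \<in> (\<Pi>\<^sub>E k\<in>{1..n}. mspace (m k))"
        using measurable_space[OF \<xi>m] mspace_product by auto
      then show "\<xi> \<omega> = (\<lambda>k\<in>{1..n}. \<xi> \<omega> k)"
        by (simp add: PiE_restrict del: One_nat_def)
    qed
    also have "\<dots> = PiM {1..n} P"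
      using M.indep_vars_iff_distr_eq_PiM'[of "{1..n}" "\<lambda>k \<omega>. \<xi> \<omega> k" "\<lambda>k. mborel (m k)"] \<xi>k assms(2,7)
      by (simp add: P_def[abs_def])
    finally show ?thesis .
  qed
  have Xm: "X i \<in> measurable M (mborel \<rho>)" if "i \<in> {1..N}" for i
    using assms(9) that by (simp add: M.indep_vars_def)
  have sample: "X i \<omega> k \<in> mspace (m k)" if "i \<in> {1..N}" "k \<in> {1..n}" "\<omega> \<in> space M" for i k \<omega>
    using measurable_space[OF Xm[OF that(1)] that(3)] that(2) by (auto simp: mspace_product PiE_iff)
  have Q_prob: "prob_space (Q \<omega> k)" if "\<omega> \<in> space M" "k \<in> {1..n}" for \<omega> k
    unfolding Q_def using assms(3) sample that by (intro prob_space_empirical) auto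
  \<comment> \<open>Finite moments are part of membership in a Wasserstein ball, so one outcome in
    \<open>E k\<close> is enough.\<close>
  have P_moment: "P k \<in> probs_moment p (m k)" if "k \<in> {1..n}" for k
  proof -
    have "0 < measure M (E k)"
      using E_prob[OF that] \<beta>[OF that] by simp
    then have "E k \<noteq> {}" by auto
    then show ?thesis by (auto simp: E_def wasserstein_ball_def)
  qed
  have emp: "empirical_coupling (P k) (m k) N p" if "k \<in> {1..n}" for k
    using P_prob[OF that] separable_factor[OF that] assms(1,3)
    by (simp add: empirical_coupling_def empirical_coupling_axioms_def P_def)
  \<comment> \<open>The ball event as a set of extensional samples in component \<open>k\<close>, so
    that \<open>E k\<close> depends only on column \<open>k\<close> of the array.\<close>
  define G where "G k = {x \<in> {1..N} \<rightarrow>\<^sub>E mspace (m k).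
      wasserstein p (m k) (empirical (mborel (m k)) N x) (P k) \<le> \<epsilon> k}" for k
  have G: "G k \<in> sets (PiM {1..N} (\<lambda>_. mborel (m k)))" if "k \<in> {1..n}" for k
    unfolding G_def
    by (rule empirical_coupling.measurable_wasserstein_empirical_le[OF emp P_moment]) (use that assms(11) in auto)
  have E_G: "E k = {\<omega> \<in> space M. (\<lambda>i\<in>{1..N}. X i \<omega> k) \<in> G k}" if k: "k \<in> {1..n}" for k
  proof -
    have "Q \<omega> k = empirical (mborel (m k)) N (\<lambda>i\<in>{1..N}. X i \<omega> k)" for \<omega>
      unfolding Q_def by (rule empirical_cong) simp
    moreover have "(\<lambda>i\<in>{1..N}. X i \<omega> k) \<in> {1..N} \<rightarrow>\<^sub>E mspace (m k)" if "\<omega> \<in> space M" for \<omega>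
      using sample k that by (intro restrict_PiE_iff[THEN iffD2] ballI)
    ultimately show ?thesis
      using P_moment[OF k] by (auto simp: E_def G_def wasserstein_ball_def simp del: One_nat_def)
  qed
  \<comment> \<open>Equality is required here: a mere inclusion of the measurable intersection would
    give no lower bound for a set not known to be measurable.\<close>
  have "{\<omega> \<in> space M. distr M (mborel \<rho>) \<xi>
        \<in> multi_transport_hyperrectangle p n m \<rho> (product_empirical n m N (\<lambda>i. X i \<omega>)) \<epsilon>} = (\<Inter>k\<in>{1..n}. E k)"
    (is "?T = _")
  proof (intro antisym subsetI)
    fix \<omega> assume "\<omega> \<in> ?T"
    then have \<omega>: "\<omega> \<in> space M" and mem: "PiM {1..n} P \<in> multi_transport_hyperrectangle p n m \<rho> (PiM {1..n} (Q \<omega>)) \<epsilon>"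
      by (simp_all add: law product_empirical_def Q_def[abs_def])
    show "\<omega> \<in> (\<Inter>k\<in>{1..n}. E k)"
    proof
      fix k assume k: "k \<in> {1..n}"
      have x: "(\<lambda>i. X i \<omega> k) \<in> {1..N} \<rightarrow> mspace (m k)"
        using sample k \<omega> by auto
      obtain \<pi> where "\<pi> \<in> couplings (m k) (Q \<omega> k) (P k)"
        "(\<integral>\<^sup>+ z. ennreal (mdist (m k) (fst z) (snd z) powr p) \<partial>\<pi>) \<le> ennreal (\<epsilon> k powr p)"
        using hyperrectangle_component_coupling[OF Q_prob[OF \<omega>] P_prob _ _ mem k]
        by (auto simp: Q_def P_def)
      then have "wasserstein p (m k) (Q \<omega> k) (P k) \<le> \<epsilon> k"
        unfolding Q_def
        by (rule empirical_coupling.wasserstein_le_of_coupling[OF emp[OF k] P_moment[OF k] x assms(11)[OF k]])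
      then show "\<omega> \<in> E k"
        using \<omega> P_moment[OF k] by (simp add: E_def wasserstein_ball_def)
    qed
  next
    fix \<omega> assume \<omega>E: "\<omega> \<in> (\<Inter>k\<in>{1..n}. E k)"
    then have \<omega>: "\<omega> \<in> space M"
      using assms(2) by (auto simp: E_def)
    have "\<exists>\<pi>. \<pi> \<in> couplings (m k) (Q \<omega> k) (P k) \<and>
        (\<integral>\<^sup>+ z. ennreal (mdist (m k) (fst z) (snd z) powr p) \<partial>\<pi>) \<le> ennreal (\<epsilon> k powr p)"
      if k: "k \<in> {1..n}" for k
    proof -
      have x: "(\<lambda>i. X i \<omega> k) \<in> {1..N} \<rightarrow> mspace (m k)"
        using sample k \<omega> by auto
      have "wasserstein p (m k) (Q \<omega> k) (P k) \<le> \<epsilon> k"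
        using \<omega>E k by (auto simp: E_def wasserstein_ball_def)
      then show ?thesis
        using empirical_coupling.optimal_coupling_exists[OF emp[OF k] P_moment[OF k] x assms(11)[OF k]]
        unfolding Q_def by blast
    qed
    then obtain \<pi> where "\<And>k. k \<in> {1..n} \<Longrightarrow> \<pi> k \<in> couplings (m k) (Q \<omega> k) (P k)"
      "\<And>k. k \<in> {1..n} \<Longrightarrow>
        (\<integral>\<^sup>+ z. ennreal (mdist (m k) (fst z) (snd z) powr p) \<partial>\<pi> k) \<le> ennreal (\<epsilon> k powr p)"
      by metis
    \<comment> \<open>The optimal couplings are chosen for each component separately and then
      combined, for this fixed \<open>\<omega>\<close>; no measurability of the choice
      enters.\<close>
    then have "PiM {1..n} P \<in> multi_transport_hyperrectangle p n m \<rho> (PiM {1..n} (Q \<omega>)) \<epsilon>"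
      by (rule product_coupling_in_hyperrectangle)
    then show "\<omega> \<in> ?T"
      using \<omega> by (simp add: law product_empirical_def Q_def[abs_def])
  qed
  also have "measure M (\<Inter>k\<in>{1..n}. E k) = (\<Prod>k\<in>{1..n}. measure M (E k))"
  proof -
    have "M.indep_vars (\<lambda>(i, k). mborel (m k)) (\<lambda>(i, k) \<omega>. X i \<omega> k) ({1..N} \<times> {1..n})"
      using assms(2,3)
      by (intro M.indep_vars_array[OF _ _ _ _ assms(9) measurable_component assms(6,7,10)]) auto
    from M.prob_INT_columns[OF _ _ this G] show ?thesis
      using assms(2) E_G by (simp del: One_nat_def)
  qed
  also have "(\<Prod>k\<in>{1..n}. 1 - \<beta> k) \<le> (\<Prod>k\<in>{1..n}. measure M (E k))"
    using E_prob \<beta> by (intro prod_mono) (auto simp: less_imp_le)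
  finally show ?thesis .
qed

end
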